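(* Let $f(x)=\frac1M\sum_{i=1}^Mf_i(x)$ on $\mathbb{R}^n$ with each $f_i$ $L$-smooth, and suppose the variance bound on mini-batch gradients stated in the context holds. Run the mini-batch algorithm SSGDPM of the context with refresh iterations satisfying $r_{i+1}-r_i=i^\beta$ for some $\beta\in(0,1)$, and let $k_0>0$ satisfy $k_0=r_{i^\ast}$ with $i^\ast\ge\left(\frac{5}{\log(\gamma_0/2\delta)}\right)^{2/(1-\beta)}$. Let $\tau=\arg\min_{t\in[N]}\mathbb{E}[\|\nabla f(x_t)\|^2]$ be the index of the minimally obtained gradient. Then to achieve $\mathbb{E}\left[\|\nabla f(x_\tau)\|^2\right]<\epsilon^2$ it suffices that the number of iterations $N$ satisfies $$\epsilon^{-2}\left(1-\left(\frac{k_0}{N}\right)^{\frac{\beta}{1+\beta}}\right)+\frac{\sqrt{k_0}}{N^{\frac{\beta}{1+\beta}}}\lesssim N^{\frac{1-\beta}{2(1+\beta)}} ;$$ equivalently, $N=O\left(\epsilon^{-4\left(\frac{1+\beta}{1-\beta}\right)}\right)$.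
   Context: $L$-smooth means having $L$-Lipschitz gradient. For nonzero $v$, $\hat v=v/\|v\|$. The symbol $\lesssim$ hides constants (depending on problem parameters other than $\epsilon$, $N$) and smaller-order terms. Variance assumption: for a batch $B_m$ of $m$ indices sampled i.i.d. (uniformly) from $[M]$, $\mathbb{E}\left[\left\|\frac1m\sum_{i\in B_m}\nabla f_i(x)-\nabla f(x)\right\|^2\right]\le\sigma_m^2$, with $\sigma_m^2=\sigma_1^2/m$. Algorithm SSGDPM. Inputs: subspace rank $d$, alignment threshold $\delta$, batch size $m$, refresh parameter $\beta$. Start from arbitrary $x_0$. The alignment vector is newly generated ("refreshed") at iterations $r_1<r_2<\cdots$, and otherwise $v_{k-1}=v_{k-2}$. At a refresh at point $x$, the alignment vector is a mini-batch gradient $\frac1{m'}\sum_{i\in B'}\nabla f_i(x)$ with $B'$ of size $m'$ sampled i.i.d. from $[M]$ and $m'\ge\frac{\gamma_0\sigma_1^2}{(1-\gamma_0)\|\nabla f(x)\|^2}$, $\gamma_0$ being the desired initial alignment. At each step $k\ge1$, generate, conditionally on the past and $v_{k-1}$, a random $\tilde P_{k-1}\in\mathbb{R}^{n\times d}$ with columns in $v_{k-1}^\perp$, $\tilde P_{k-1}^\top\tilde P_{k-1}=I_d$, $\mathbb{E}[\tilde P_{k-1}\tilde P_{k-1}^\top]=\frac{d}{n-1}(I_n-\hat v_{k-1}\hat v_{k-1}^\top)$; set $P_{k-1}=\begin{pmatrix}\hat v_{k-1}&\tilde P_{k-1}\end{pmatrix}$; sample a batch $B_{k-1}$ of $m$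 indices i.i.d. from $[M]$; set $x_k=x_{k-1}-\alpha_{k-1}\frac1m\sum_{i\in B_{k-1}}P_{k-1}P_{k-1}^\top\nabla f_i(x_{k-1})$. Step sizes: $\alpha_k=\frac1{L\sqrt{k+1}}$, with the iteration count started at $k_0$.
   Formalization: The objective f is additionally assumed bounded below (for nonconstant affine f the claim fails), and the refresh gaps r_{i+1}-r_i are required to equal i^β only up to rounding (error less than 1), since i^β is generally not an integer. *)

theory Defs
  imports "HOL-Probability.Probability" "HOL-Library.Landau_Symbols"
begin

definition grad :: "(real^'n \<Rightarrow> real) \<Rightarrow> real^'n \<Rightarrow> real^'n" where
  "grad f x = (THE D. GDERIV f x :> D)"

definition L_smooth :: "real \<Rightarrow> (real^'n \<Rightarrow> real) \<Rightarrow> bool" where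
  "L_smooth L f \<longleftrightarrow> (\<forall>x. \<exists>D. GDERIV f x :> D) \<and> L-lipschitz_on UNIV (grad f)"

definition objective :: "nat \<Rightarrow> (nat \<Rightarrow> real^'n \<Rightarrow> real) \<Rightarrow> real^'n \<Rightarrow> real" where
  "objective M f x = (\<Sum>i=1..M. f i x) / real M"

text \<open>A mini-batch is a list of indices, since sampling is with replacement.\<close>

definition batch_grad :: "(nat \<Rightarrow> real^'n \<Rightarrow> real) \<Rightarrow> nat list \<Rightarrow> real^'n \<Rightarrow> real^'n" where
  "batch_grad f b x = (1 / real (length b)) *\<^sub>R (\<Sum>i\<leftarrow>b. grad (f i) x)"

definition batch_pmf :: "nat \<Rightarrow> nat \<Rightarrow> nat list pmf" where
  "batch_pmf M m = replicate_pmf m (pmf_of_set {1..M})"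

definition variance_bound :: "nat \<Rightarrow> (nat \<Rightarrow> real^'n \<Rightarrow> real) \<Rightarrow> real \<Rightarrow> bool" where
  "variance_bound M f \<sigma>\<^sub>1 \<longleftrightarrow>
     (\<forall>m\<ge>1. \<forall>x. measure_pmf.expectation (batch_pmf M m)
        (\<lambda>b. (norm (batch_grad f b x - grad (objective M f) x))\<^sup>2) \<le> \<sigma>\<^sub>1\<^sup>2 / real m)"

text \<open>\<open>B\<close> is a batch of \<open>m\<close> i.i.d. uniform indices from \<open>{1..M}\<close>, conditionally on the
  sub-sigma-algebra \<open>\<F>\<close>; the size \<open>m\<close> may itself be random, but must be known to \<open>\<F>\<close>.\<close>

definition sampled_batch ::
    "'w measure \<Rightarrow> 'w measure \<Rightarrow> nat \<Rightarrow> ('w \<Rightarrow> nat) \<Rightarrow> ('w \<Rightarrow> nat list) \<Rightarrow> bool" where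
  "sampled_batch \<Omega> \<F> M m B \<longleftrightarrow>
     m \<in> \<F> \<rightarrow>\<^sub>M count_space UNIV \<and> B \<in> \<Omega> \<rightarrow>\<^sub>M count_space UNIV \<and>
     (\<forall>b. AE \<omega> in \<Omega>. real_cond_exp \<Omega> \<F> (indicator {\<omega> \<in> space \<Omega>. B \<omega> = b}) \<omega>
                      = pmf (batch_pmf M (m \<omega>)) b)"

text \<open>The normalisation of \<open>v\<close> is \<open>sgn v\<close>. The matrix with first column \<open>sgn v\<close> followed by
  the columns of \<open>Pt\<close> has its columns indexed by \<open>'d option\<close>.\<close>

definition aligned_frame :: "real^'n \<Rightarrow> real^'d^'n \<Rightarrow> real^('d option)^'n" where
  "aligned_frame v Pt = (\<chi> i j. case j of None \<Rightarrow> sgn v $ i | Some l \<Rightarrow> Pt $ i $ l)"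

definition outer :: "real^'n \<Rightarrow> real^'n^'n" where
  "outer u = (\<chi> i j. u $ i * u $ j)"

definition step_size :: "real \<Rightarrow> nat \<Rightarrow> real" where
  "step_size L k = 1 / (L * sqrt (real k + 1))"

text \<open>For \<open>0 < \<beta> < 1\<close> the numbers \<open>i powr \<beta>\<close> are not all integers, so a prescribed gap of
  \<open>i powr \<beta>\<close> between consecutive refresh iterations is meant up to rounding. Any rounding is
  allowed: up, down, or rounding of the cumulative sums.\<close>

definition refresh_schedule :: "real \<Rightarrow> (nat \<Rightarrow> nat) \<Rightarrow> bool" where
  "refresh_schedule \<beta> r \<longleftrightarrow>
     (\<forall>i\<ge>1. r i < r (Suc i) \<and> \<bar>real (r (Suc i)) - real (r i) - real i powr \<beta>\<bar> < 1)"

text \<open>A run of the algorithm whose steps are numbered \<open>k\<^sub>0, k\<^sub>0 + 1, \<dots>\<close>. Step \<open>k\<close> turns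
  \<open>X (k - 1)\<close> into \<open>X k\<close>, so the starting point carries the index \<open>k\<^sub>0 - 1\<close>.
  The sub-sigma-algebras describe what is known during step \<open>k\<close>: \<open>F (k - 1)\<close> is the past,
  \<open>G (k - 1)\<close> additionally knows the alignment vector \<open>V (k - 1)\<close>, and \<open>H (k - 1)\<close>
  additionally knows the random matrix \<open>Pt (k - 1)\<close>. At a refresh, \<open>R (k - 1)\<close> is the batch
  defining the alignment vector and \<open>m' (k - 1)\<close> is its size.\<close>

locale ssgdpm = prob_space \<Omega>
  for \<Omega> :: "'w measure" +
  fixes M :: nat and f :: "nat \<Rightarrow> real^'n \<Rightarrow> real" and L \<sigma>\<^sub>1 \<gamma>\<^sub>0 :: real and m :: nat
    and x\<^sub>0 :: "real^'n" and r :: "nat \<Rightarrow> nat" and k\<^sub>0 :: nat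
    and F G H :: "nat \<Rightarrow> 'w measure"
    and X V :: "nat \<Rightarrow> 'w \<Rightarrow> real^'n" and Pt :: "nat \<Rightarrow> 'w \<Rightarrow> real^'d^'n"
    and B R :: "nat \<Rightarrow> 'w \<Rightarrow> nat list" and m' :: "nat \<Rightarrow> 'w \<Rightarrow> nat"
  assumes filtration: "\<And>k. k \<ge> k\<^sub>0 \<Longrightarrow> subalgebra \<Omega> (F (k - 1)) \<and> subalgebra (G (k - 1)) (F (k - 1)) \<and>
        subalgebra (H (k - 1)) (G (k - 1)) \<and> subalgebra (F k) (H (k - 1)) \<and> subalgebra \<Omega> (F k)"
    and start: "AE \<omega> in \<Omega>. X (k\<^sub>0 - 1) \<omega> = x\<^sub>0"
    and X_measurable: "\<And>k. k \<ge> k\<^sub>0 \<Longrightarrow> X (k - 1) \<in> borel_measurable (F (k - 1))"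
    and V_measurable: "\<And>k. k \<ge> k\<^sub>0 \<Longrightarrow> V (k - 1) \<in> borel_measurable (G (k - 1))"
    and Pt_measurable: "\<And>k. k \<ge> k\<^sub>0 \<Longrightarrow> Pt (k - 1) \<in> borel_measurable (H (k - 1))"
    and V_nonzero: "\<And>k. k \<ge> k\<^sub>0 \<Longrightarrow> AE \<omega> in \<Omega>. V (k - 1) \<omega> \<noteq> 0"
    and no_refresh: "\<And>k. k > k\<^sub>0 \<Longrightarrow> k \<notin> r ` {1..} \<Longrightarrow> AE \<omega> in \<Omega>. V (k - 1) \<omega> = V (k - 2) \<omega>"
    and refresh_batch: "\<And>k. k \<ge> k\<^sub>0 \<Longrightarrow> k \<in> r ` {1..} \<Longrightarrow>
        sampled_batch \<Omega> (F (k - 1)) M (m' (k - 1)) (R (k - 1))"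
    and refresh_size: "\<And>k. k \<ge> k\<^sub>0 \<Longrightarrow> k \<in> r ` {1..} \<Longrightarrow> AE \<omega> in \<Omega>. m' (k - 1) \<omega> \<ge> 1 \<and>
        (grad (objective M f) (X (k - 1) \<omega>) \<noteq> 0 \<longrightarrow>
         real (m' (k - 1) \<omega>)
           \<ge> \<gamma>\<^sub>0 * \<sigma>\<^sub>1\<^sup>2 / ((1 - \<gamma>\<^sub>0) * (norm (grad (objective M f) (X (k - 1) \<omega>)))\<^sup>2))"
    and refresh: "\<And>k. k \<ge> k\<^sub>0 \<Longrightarrow> k \<in> r ` {1..} \<Longrightarrow>
        AE \<omega> in \<Omega>. V (k - 1) \<omega> = batch_grad f (R (k - 1) \<omega>) (X (k - 1) \<omega>)"
    and Pt_orthogonal: "\<And>k. k \<ge> k\<^sub>0 \<Longrightarrow>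
        AE \<omega> in \<Omega>. \<forall>l. column l (Pt (k - 1) \<omega>) \<bullet> V (k - 1) \<omega> = 0"
    and Pt_orthonormal: "\<And>k. k \<ge> k\<^sub>0 \<Longrightarrow>
        AE \<omega> in \<Omega>. transpose (Pt (k - 1) \<omega>) ** Pt (k - 1) \<omega> = mat 1"
    and Pt_moment: "\<And>k i j. k \<ge> k\<^sub>0 \<Longrightarrow>
        AE \<omega> in \<Omega>. real_cond_exp \<Omega> (G (k - 1))
            (\<lambda>\<omega>. (Pt (k - 1) \<omega> ** transpose (Pt (k - 1) \<omega>)) $ i $ j) \<omega>
          = real CARD('d) / (real CARD('n) - 1) * (mat 1 - outer (sgn (V (k - 1) \<omega>))) $ i $ j"
    and batch: "\<And>k. k \<ge> k\<^sub>0 \<Longrightarrow> sampled_batch \<Omega> (H (k - 1)) M (\<lambda>_. m) (B (k - 1))"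
    and step: "\<And>k. k \<ge> k\<^sub>0 \<Longrightarrow> AE \<omega> in \<Omega>.
        (let P = aligned_frame (V (k - 1) \<omega>) (Pt (k - 1) \<omega>) in
         X k \<omega> = X (k - 1) \<omega> - step_size L (k - 1) *\<^sub>R
           ((1 / real m) *\<^sub>R (\<Sum>i\<leftarrow>B (k - 1) \<omega>. (P ** transpose P) *v grad (f i) (X (k - 1) \<omega>))))"

text \<open>The sufficient condition on \<open>N\<close>, with hidden constant \<open>c\<close>.\<close>

definition enough_iterations :: "real \<Rightarrow> real \<Rightarrow> nat \<Rightarrow> real \<Rightarrow> nat \<Rightarrow> bool" where
  "enough_iterations c \<beta> k\<^sub>0 \<epsilon> N \<longleftrightarrow> k\<^sub>0 \<le> N \<and>
     1 / \<epsilon>\<^sup>2 * (1 - (real k\<^sub>0 / real N) powr (\<beta> / (1 + \<beta>)))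
       + sqrt (real k\<^sub>0) / real N powr (\<beta> / (1 + \<beta>))
     \<le> c * real N powr ((1 - \<beta>) / (2 * (1 + \<beta>)))"

end

theory Submission
  imports Defs
begin

text \<open>
  Write \<open>A = P P\<^sup>T\<close>, an orthogonal projection. The descent lemma and unbiasedness of the batch
  give a decrease of \<open>\<alpha> / 2 \<cdot> E \<parallel>A \<nabla>f\<parallel>\<^sup>2\<close> per step, up to an error of order \<open>\<alpha>\<^sup>2\<close>. The moment condition
  on the random part of the frame yields \<open>E \<parallel>A \<nabla>f\<parallel>\<^sup>2 \<ge> E \<parallel>\<nabla>f\<parallel>\<^sup>2 / n\<close> whatever the alignment vector
  is, so telescoping from \<open>k\<^sub>0\<close> to \<open>N\<close> bounds the smallest expected squared gradient by a multiple
  of \<open>(1 + ln N) \<surd>N / (N - k\<^sub>0)\<close>. Put \<open>p = \<beta> / (1 + \<beta>)\<close> and \<open>q = (1 - \<beta>) / (2 (1 + \<beta>))\<close>; as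
  \<open>p + q = 1 / 2\<close>, a hidden constant \<open>c \<le> 1 / 2\<close> in the condition on \<open>N\<close> forces \<open>4 k\<^sub>0 \<le> N\<close> through its
  second term, and then \<open>\<epsilon>\<^sup>-\<^sup>2 = O(c N\<^sup>q)\<close> through its first. The bound is thus
  \<open>O(N\<^sup>p\<^sup>-\<^sup>1\<^sup>/\<^sup>2) = O(N\<^sup>-\<^sup>q)\<close>, which is below \<open>\<epsilon>\<^sup>2\<close> once \<open>c\<close> is small.
\<close>

subsection \<open>Gradients and mini-batches\<close>

text \<open>Since \<open>grad\<close> is a definite description, it needs uniqueness: two gradients
  at a point represent the same Frechet derivative, and a vector is determined by its inner
  products.\<close>

lemma grad_eqI:
  assumes "GDERIV f x :> D"
  shows "grad f x = D"
  unfolding grad_def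
proof (rule the_equality)
  show "GDERIV f x :> D"
    by (rule assms)
  fix D' assume "GDERIV f x :> D'"
  then have "(\<lambda>h. h \<bullet> D') = (\<lambda>h. h \<bullet> D)"
    using assms has_derivative_unique unfolding gderiv_def by blast
  then show "D' = D"
    using vector_eq_ldot[of D' D] by (simp only: fun_eq_iff)
qed

lemma GDERIV_grad: "L_smooth L f \<Longrightarrow> GDERIV f x :> grad f x"
  unfolding L_smooth_def using grad_eqI by metis

lemma L_smooth_continuous:
  assumes "L_smooth L f"
  shows "continuous_on UNIV f" "continuous_on UNIV (grad f)"
proof -
  have "continuous (at x) f" for x
    using GDERIV_grad[OF assms, of x] unfolding gderiv_def by (rule has_derivative_continuous)
  then show "continuous_on UNIV f"
    by (simp add: continuous_at_imp_continuous_on)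
  show "continuous_on UNIV (grad f)"
    using assms lipschitz_on_continuous_on unfolding L_smooth_def by blast
qed

text \<open>Along the segment, \<open>\<phi>\<close> is f minus the claimed linear and quadratic
  terms. Cauchy-Schwarz and the Lipschitz bound make its derivative nonpositive for t \<ge> 0, so
  \<phi>(1) \<le> \<phi>(0), which is the claim.\<close>

lemma descent_lemma:
  assumes "L_smooth L f"
  shows "f (x + h) \<le> f x + grad f x \<bullet> h + L / 2 * (norm h)\<^sup>2"
proof -
  define \<phi> where "\<phi> t = f (x + t *\<^sub>R h) - t * (grad f x \<bullet> h) - L / 2 * t\<^sup>2 * (norm h)\<^sup>2" for t
  have "\<exists>y. (\<phi> has_real_derivative y) (at t) \<and> y \<le> 0" if "0 \<le> t" for t
  proof (intro exI conjI)
    have 1: "((\<lambda>t. x + t *\<^sub>R h) has_derivative (\<lambda>s. s *\<^sub>R h)) (at t)"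
      by (auto intro!: derivative_eq_intros)
    have "((\<lambda>t. f (x + t *\<^sub>R h)) has_derivative (\<lambda>s. (s *\<^sub>R h) \<bullet> grad f (x + t *\<^sub>R h))) (at t)"
      using has_derivative_compose[OF 1 GDERIV_grad[OF assms, unfolded gderiv_def]] .
    then have d: "((\<lambda>t. f (x + t *\<^sub>R h)) has_real_derivative grad f (x + t *\<^sub>R h) \<bullet> h) (at t)"
      unfolding has_field_derivative_def by (simp add: mult.commute[of _ "h \<bullet> _"] inner_commute)
    show "(\<phi> has_real_derivative
        (grad f (x + t *\<^sub>R h) \<bullet> h - grad f x \<bullet> h - L * t * (norm h)\<^sup>2)) (at t)"
      unfolding \<phi>_def by (rule derivative_eq_intros d refl)+ (simp add: algebra_simps)
    have "(grad f (x + t *\<^sub>R h) - grad f x) \<bullet> h \<le> norm (grad f (x + t *\<^sub>R h) - grad f x) * norm h"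
      by (rule norm_cauchy_schwarz)
    also have "norm (grad f (x + t *\<^sub>R h) - grad f x) \<le> L * norm (t *\<^sub>R h)"
      using lipschitz_onD[of L UNIV "grad f" "x + t *\<^sub>R h" x] assms
      unfolding L_smooth_def dist_norm by simp
    finally have "(grad f (x + t *\<^sub>R h) - grad f x) \<bullet> h \<le> L * norm (t *\<^sub>R h) * norm h"
      by (simp add: mult_right_mono)
    then show "grad f (x + t *\<^sub>R h) \<bullet> h - grad f x \<bullet> h - L * t * (norm h)\<^sup>2 \<le> 0"
      using that by (simp add: inner_diff_left power2_eq_square mult_ac)
  qed
  then have "\<phi> 1 \<le> \<phi> 0"
    using DERIV_nonpos_imp_nonincreasing[of 0 1 \<phi>] zero_le_one by blast
  then show ?thesis
    by (simp add: \<phi>_def)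
qed

lemma GDERIV_objective:
  assumes "\<forall>i\<in>{1..M}. L_smooth L (f i)"
  shows "GDERIV (objective M f) x :> (1 / real M) *\<^sub>R (\<Sum>i=1..M. grad (f i) x)"
proof -
  have "((\<lambda>x. (\<Sum>i=1..M. f i x) / real M) has_derivative
      (\<lambda>h. (\<Sum>i=1..M. h \<bullet> grad (f i) x) / real M)) (at x)"
    using assms GDERIV_grad[unfolded gderiv_def]
    by (intro bounded_linear.has_derivative[OF bounded_linear_divide] has_derivative_sum) blast
  then show ?thesis
    unfolding gderiv_def objective_def[abs_def] by (simp add: inner_sum_right)
qed

lemma grad_objective:
  assumes "\<forall>i\<in>{1..M}. L_smooth L (f i)"
  shows "grad (objective M f) x = (1 / real M) *\<^sub>R (\<Sum>i=1..M. grad (f i) x)"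
  using GDERIV_objective[OF assms] by (rule grad_eqI)

lemma L_smooth_objective:
  assumes f: "\<forall>i\<in>{1..M}. L_smooth L (f i)" and "L \<ge> 0"
  shows "L_smooth L (objective M f)"
  unfolding L_smooth_def
proof (intro conjI allI exI lipschitz_onI)
  show "GDERIV (objective M f) x :> (1 / real M) *\<^sub>R (\<Sum>i=1..M. grad (f i) x)" for x
    using f by (rule GDERIV_objective)
  fix x y
  have "norm (\<Sum>i=1..M. grad (f i) x - grad (f i) y) \<le> (\<Sum>i=1..M. L * norm (x - y))"
    using f unfolding L_smooth_def lipschitz_on_def dist_norm
    by (intro order_trans[OF norm_sum] sum_mono) auto
  \<comment> \<open>For M = 0 the quotient is 0 by convention, and L \<ge> 0 settles the
    inequality.\<close>
  then have "norm (\<Sum>i=1..M. grad (f i) x - grad (f i) y) / real M \<le> L * norm (x - y)"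
    using \<open>L \<ge> 0\<close> by (cases "M = 0") (simp_all add: field_simps)
  then show "dist (grad (objective M f) x) (grad (objective M f) y) \<le> L * dist x y"
    unfolding grad_objective[OF f] dist_norm
    by (simp add: sum_subtractf flip: scaleR_diff_right)
next
  show "0 \<le> L" by fact
qed

section \<open>Expectations over a uniformly sampled batch\<close>

lemma set_batch_pmf:
  assumes "M \<ge> 1"
  shows "set_pmf (batch_pmf M m) = {b. set b \<subseteq> {1..M} \<and> length b = m}"
proof -
  have "set_pmf (pmf_of_set {1..M}) = {1..M}"
    using assms by (intro set_pmf_of_set) auto
  then show ?thesis
    unfolding batch_pmf_def set_replicate_pmf by auto
qed

lemma finite_set_batch_pmf: "M \<ge> 1 \<Longrightarrow> finite (set_pmf (batch_pmf M m))"
  by (simp add: set_batch_pmf finite_lists_length_eq)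

text \<open>Induction on the batch size: a batch of size m + 1 is a uniform index followed by a
  batch of size m, and each index contributes the average of h.\<close>

lemma expectation_batch_sum:
  fixes h :: "nat \<Rightarrow> 'a :: {banach, second_countable_topology}"
  assumes "M \<ge> 1"
  shows "measure_pmf.expectation (batch_pmf M m) (\<lambda>b. \<Sum>i\<leftarrow>b. h i)
    = (real m / real M) *\<^sub>R (\<Sum>i=1..M. h i)"
proof (induction m)
  case 0
  then show ?case by (simp add: batch_pmf_def)
next
  case (Suc m)
  let ?E = "measure_pmf.expectation"
  have eq: "batch_pmf M (Suc m) = pmf_of_set {1..M} \<bind> (\<lambda>i. map_pmf ((#) i) (batch_pmf M m))"
    by (simp add: batch_pmf_def map_pmf_def)
  have fin: "finite (set_pmf (batch_pmf M m))"
    using assms by (rule finite_set_batch_pmf)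
  have "?E (map_pmf ((#) i) (batch_pmf M m)) (\<lambda>b. \<Sum>i\<leftarrow>b. h i)
      = h i + (real m / real M) *\<^sub>R (\<Sum>i=1..M. h i)" for i
    using fin Suc by (simp add: integrable_measure_pmf_finite)
  then have "?E (batch_pmf M (Suc m)) (\<lambda>b. \<Sum>i\<leftarrow>b. h i)
      = (\<Sum>i=1..M. (h i + (real m / real M) *\<^sub>R (\<Sum>i=1..M. h i)) /\<^sub>R real M)"
    unfolding eq using assms fin by (subst pmf_expectation_bind_pmf_of_set) auto
  also have "\<dots> = (real (Suc m) / real M) *\<^sub>R (\<Sum>i=1..M. h i)"
    using assms
    by (simp add: sum.distrib scaleR_add_right sum_constant_scaleR del: sum_constant
        flip: scaleR_sum_right) (simp add: field_simps flip: scaleR_add_left)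
  finally show ?case .
qed

lemma expectation_batch_grad:
  assumes "M \<ge> 1" "m \<ge> 1" and f: "\<forall>i\<in>{1..M}. L_smooth L (f i)"
  shows "measure_pmf.expectation (batch_pmf M m) (\<lambda>b. batch_grad f b x) = grad (objective M f) x"
proof -
  \<comment> \<open>On the support every batch has length m, so the random factor 1 / length b
    becomes a constant and leaves the expectation.\<close>
  have "measure_pmf.expectation (batch_pmf M m) (\<lambda>b. batch_grad f b x)
      = measure_pmf.expectation (batch_pmf M m) (\<lambda>b. (1 / real m) *\<^sub>R (\<Sum>i\<leftarrow>b. grad (f i) x))"
    by (intro integral_cong_AE) (auto simp: AE_measure_pmf_iff set_batch_pmf[OF assms(1)] batch_grad_def)
  then show ?thesis
    using assms by (simp add: expectation_batch_sum grad_objective[OF f])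
qed

subsection \<open>Projections onto frames\<close>

lemma aligned_frame_orthonormal:
  fixes Q :: "real^'d^'n"
  assumes "v \<noteq> 0" "\<forall>l. column l Q \<bullet> v = 0" "transpose Q ** Q = mat 1"
  shows "transpose (aligned_frame v Q) ** aligned_frame v Q = mat 1"
proof -
  have c: "column None (aligned_frame v Q) = sgn v"
    "column (Some l) (aligned_frame v Q) = column l Q" for l
    by (simp_all add: column_def aligned_frame_def)
  have "column i Q \<bullet> column j Q = (if i = j then 1 else 0)" for i j
    using assms(3) by (simp add: matrix_mult_transpose_dot_column mat_def vec_eq_iff)
  moreover have "sgn v \<bullet> sgn v = 1"
    using assms(1) by (simp add: dot_square_norm norm_sgn)
  moreover have "column l Q \<bullet> sgn v = 0" "sgn v \<bullet> column l Q = 0" for l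
    using assms(2) by (simp_all add: sgn_div_norm inner_commute)
  ultimately have "column i (aligned_frame v Q) \<bullet> column j (aligned_frame v Q)
      = (if i = j then 1 else 0)" for i j
    by (cases i; cases j) (auto simp: c)
  then show ?thesis
    by (simp add: matrix_mult_transpose_dot_column mat_def vec_eq_iff)
qed

text \<open>The added column contributes a rank-one summand. This separates the alignment direction
  from the random part, whose conditional mean is prescribed.\<close>

lemma aligned_frame_mult_transpose:
  "aligned_frame v Q ** transpose (aligned_frame v Q) = outer (sgn v) + Q ** transpose Q"
  by (simp add: vec_eq_iff matrix_matrix_mult_def transpose_def aligned_frame_def outer_def
      UNIV_option_conv sum.reindex)

text \<open>A left inverse makes the matrix injective, and an injective linear map cannot lower the
  dimension.\<close>

lemma frame_card_le:
  fixes P :: "real^'k^'n"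
  assumes "transpose P ** P = mat 1"
  shows "CARD('k) \<le> CARD('n)"
proof -
  have "inj ((*v) P)"
    using assms matrix_left_invertible_injective by blast
  then have "dim (range ((*v) P)) = dim (UNIV :: (real^'k) set)"
    by (intro dim_image_eq) auto
  then show ?thesis
    using dim_subset_UNIV[of "range ((*v) P)"] by simp
qed

lemma inner_frame_projection:
  fixes P :: "real^'k^'n"
  shows "((P ** transpose P) *v u) \<bullet> w = u \<bullet> ((P ** transpose P) *v w)"
  by (metis dot_lmul_matrix matrix_transpose_mul transpose_matrix_vector transpose_transpose)

lemma frame_projection_idem:
  fixes P :: "real^'k^'n"
  assumes "transpose P ** P = mat 1"
  shows "(P ** transpose P) *v ((P ** transpose P) *v u) = (P ** transpose P) *v u"
proof -
  have "(P ** transpose P) ** (P ** transpose P) = P ** (transpose P ** P) ** transpose P"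
    by (simp add: matrix_mul_assoc)
  then show ?thesis
    by (simp add: assms matrix_vector_mul_assoc)
qed

text \<open>Symmetry and idempotence give the first claim; Cauchy-Schwarz applied to its right-hand
  side then shows that the projection does not increase norms.\<close>

lemma norm_frame_projection:
  fixes P :: "real^'k^'n"
  assumes "transpose P ** P = mat 1"
  shows "(norm ((P ** transpose P) *v u))\<^sup>2 = u \<bullet> ((P ** transpose P) *v u)"
    and "norm ((P ** transpose P) *v u) \<le> norm u"
proof -
  let ?A = "P ** transpose P"
  show eq: "(norm (?A *v u))\<^sup>2 = u \<bullet> (?A *v u)"
    by (simp add: power2_norm_eq_inner inner_frame_projection frame_projection_idem[OF assms])
  have "(norm (?A *v u))\<^sup>2 \<le> norm u * norm (?A *v u)"
    unfolding eq by (rule norm_cauchy_schwarz)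
  then show "norm (?A *v u) \<le> norm u"
    by (cases "norm (?A *v u) = 0") (auto simp: power2_eq_square)
qed

subsection \<open>Descent in expectation over the batch\<close>

text \<open>Write the batch gradient as g + e with e of mean zero. The frame is fixed here, so the
  terms linear in e vanish in expectation, and the quadratic one is bounded by the variance because
  the projection A does not increase norms.\<close>

lemma expected_descent_step:
  fixes P :: "real^'k^'n" and x :: "real^'n"
  assumes "M \<ge> 1" "m \<ge> 1" "L \<ge> 0" and f: "\<forall>i\<in>{1..M}. L_smooth L (f i)"
    and var: "variance_bound M f \<sigma>\<^sub>1" and P: "transpose P ** P = mat 1"
  defines "A \<equiv> P ** transpose P" and "g \<equiv> grad (objective M f) x"
  shows "measure_pmf.expectation (batch_pmf M m)
      (\<lambda>b. objective M f (x - \<alpha> *\<^sub>R (A *v batch_grad f b x)))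
    \<le> objective M f x - (\<alpha> - L * \<alpha>\<^sup>2 / 2) * (norm (A *v g))\<^sup>2 + L * \<alpha>\<^sup>2 / 2 * (\<sigma>\<^sub>1\<^sup>2 / real m)"
proof -
  let ?E = "measure_pmf.expectation (batch_pmf M m)"
  have int [simp]: "integrable (measure_pmf (batch_pmf M m)) h" for h :: "nat list \<Rightarrow> 'b :: {banach, second_countable_topology}"
    using assms(1) by (intro integrable_measure_pmf_finite finite_set_batch_pmf)
  define e where "e b = batch_grad f b x - g" for b
  have bg: "batch_grad f b x = g + e b" for b
    by (simp add: e_def)
  have e0: "?E e = 0"
    unfolding e_def g_def using assms by (simp add: expectation_batch_grad)
  have AA: "A *v (A *v u) = A *v u" for u
    unfolding A_def using P by (rule frame_projection_idem)
  have sym: "(A *v u) \<bullet> w = u \<bullet> (A *v w)" for u w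
    unfolding A_def by (rule inner_frame_projection)
  define w where "w = A *v g"
  have ww: "g \<bullet> w = (norm w)\<^sup>2"
    using norm_frame_projection(1)[OF P, of g] by (simp add: w_def A_def)
  \<comment> \<open>The coefficient of \<open>w \<bullet> e b\<close> collects -\<alpha> from the
    linear term of the descent lemma and L * \<alpha>^2 from the cross term of the squared
    norm.\<close>
  have "objective M f (x - \<alpha> *\<^sub>R (A *v batch_grad f b x))
      \<le> objective M f x - (\<alpha> - L * \<alpha>\<^sup>2 / 2) * (norm w)\<^sup>2 + L * \<alpha>\<^sup>2 / 2 * (norm (e b))\<^sup>2
        - (\<alpha> - L * \<alpha>\<^sup>2) * (w \<bullet> e b)" for b
  proof -
    let ?h = "A *v batch_grad f b x"
    have h: "?h = w + A *v e b"
      by (simp add: bg w_def matrix_vector_right_distrib)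
    have 1: "g \<bullet> ?h = (norm w)\<^sup>2 + w \<bullet> e b"
      by (simp add: h inner_add_right ww sym[symmetric] flip: w_def)
    have "(norm ?h)\<^sup>2 = (norm w)\<^sup>2 + 2 * (w \<bullet> (A *v e b)) + (norm (A *v e b))\<^sup>2"
      unfolding h power2_norm_eq_inner by (simp add: inner_add_left inner_add_right inner_commute)
    also have "w \<bullet> (A *v e b) = w \<bullet> e b"
      by (simp add: w_def AA flip: sym)
    also have "(norm (A *v e b))\<^sup>2 \<le> (norm (e b))\<^sup>2"
      unfolding A_def using norm_frame_projection(2)[OF P] by (intro power_mono) auto
    finally have 2: "(norm ?h)\<^sup>2 \<le> (norm w)\<^sup>2 + 2 * (w \<bullet> e b) + (norm (e b))\<^sup>2"
      by simp
    have "objective M f (x + (- \<alpha>) *\<^sub>R ?h)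
        \<le> objective M f x + g \<bullet> ((- \<alpha>) *\<^sub>R ?h) + L / 2 * (norm ((- \<alpha>) *\<^sub>R ?h))\<^sup>2"
      unfolding g_def using L_smooth_objective[OF f \<open>L \<ge> 0\<close>] by (rule descent_lemma)
    also have "\<dots> = objective M f x - \<alpha> * (g \<bullet> ?h) + L * \<alpha>\<^sup>2 / 2 * (norm ?h)\<^sup>2"
      by (simp add: power_mult_distrib)
    also have "\<dots> \<le> objective M f x - \<alpha> * ((norm w)\<^sup>2 + w \<bullet> e b)
        + L * \<alpha>\<^sup>2 / 2 * ((norm w)\<^sup>2 + 2 * (w \<bullet> e b) + (norm (e b))\<^sup>2)"
      unfolding 1 using 2 \<open>L \<ge> 0\<close> by (intro add_left_mono mult_left_mono) auto
    finally show ?thesis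
      by (simp add: algebra_simps)
  qed
  then have "?E (\<lambda>b. objective M f (x - \<alpha> *\<^sub>R (A *v batch_grad f b x)))
      \<le> ?E (\<lambda>b. objective M f x - (\<alpha> - L * \<alpha>\<^sup>2 / 2) * (norm w)\<^sup>2 + L * \<alpha>\<^sup>2 / 2 * (norm (e b))\<^sup>2
        - (\<alpha> - L * \<alpha>\<^sup>2) * (w \<bullet> e b))"
    by (intro integral_mono) auto
  also have "\<dots> = objective M f x - (\<alpha> - L * \<alpha>\<^sup>2 / 2) * (norm w)\<^sup>2
      + L * \<alpha>\<^sup>2 / 2 * ?E (\<lambda>b. (norm (e b))\<^sup>2) - (\<alpha> - L * \<alpha>\<^sup>2) * (w \<bullet> ?E e)"
    by simp
  also have "\<dots> \<le> objective M f x - (\<alpha> - L * \<alpha>\<^sup>2 / 2) * (norm w)\<^sup>2 + L * \<alpha>\<^sup>2 / 2 * (\<sigma>\<^sub>1\<^sup>2 / real m)"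
  proof -
    have "?E (\<lambda>b. (norm (e b))\<^sup>2) \<le> \<sigma>\<^sub>1\<^sup>2 / real m"
      using var \<open>m \<ge> 1\<close> unfolding variance_bound_def e_def g_def by blast
    then show ?thesis
      using \<open>L \<ge> 0\<close> unfolding e0 by (simp add: mult_left_mono del: times_divide_eq_right times_divide_eq_left)
  qed
  finally show ?thesis
    unfolding w_def .
qed

text \<open>A crude affine growth bound: each gradient is compared with its value at the origin, and
  the sum of all M values there dominates each one. It serves to bound the iterates.\<close>

lemma norm_batch_grad_le:
  assumes "m \<ge> 1" "L \<ge> 0" and f: "\<forall>i\<in>{1..M}. L_smooth L (f i)"
    and b: "set b \<subseteq> {1..M}" "length b = m"
  shows "norm (batch_grad f b x) \<le> (\<Sum>i=1..M. norm (grad (f i) 0)) + L * norm x"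
proof -
  define K where "K = (\<Sum>i=1..M. norm (grad (f i) 0)) + L * norm x"
  have g: "norm (grad (f i) x) \<le> K" if "i \<in> {1..M}" for i
  proof -
    have "norm (grad (f i) x - grad (f i) 0) \<le> L * norm (x - 0)"
      using lipschitz_onD[of L UNIV "grad (f i)" x 0] f that
      unfolding L_smooth_def dist_norm by simp
    moreover have "norm (grad (f i) 0) \<le> (\<Sum>i=1..M. norm (grad (f i) 0))"
      using that by (intro member_le_sum) auto
    ultimately show ?thesis
      using norm_triangle_sub[of "grad (f i) x" "grad (f i) 0"] by (simp add: K_def)
  qed
  have "norm (\<Sum>i\<leftarrow>b'. grad (f i) x) \<le> real (length b') * K" if "set b' \<subseteq> {1..M}" for b'
    using that
  proof (induction b')
    case (Cons i b')
    then have "norm (\<Sum>i\<leftarrow>b'. grad (f i) x) \<le> real (length b') * K" "norm (grad (f i) x) \<le> K"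
      using g by auto
    then show ?case
      using norm_triangle_ineq[of "grad (f i) x" "\<Sum>i\<leftarrow>b'. grad (f i) x"]
      by (simp add: algebra_simps)
  qed simp
  from this[OF b(1)] show ?thesis
    using assms(1) b(2) unfolding K_def[symmetric] by (simp add: batch_grad_def field_simps)
qed

subsection \<open>Measurability and sampling\<close>

lemma sum_list_matrix_vector:
  fixes A :: "real^'n^'m"
  shows "(\<Sum>i\<leftarrow>b. A *v h i) = A *v (\<Sum>i\<leftarrow>b. h i)"
  by (induction b) (simp_all add: matrix_vector_right_distrib)

text \<open>Measurability is tested on the basis vectors \<open>axis i u\<close>. The entries are of
  any Euclidean type, so that two applications reduce a matrix to its real entries.\<close>

lemma borel_measurable_vecI:
  fixes Z :: "'a \<Rightarrow> 'b::euclidean_space^'n"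
  assumes "\<And>i. (\<lambda>\<omega>. Z \<omega> $ i) \<in> borel_measurable N"
  shows "Z \<in> borel_measurable N"
proof (subst borel_measurable_euclidean_space, rule ballI)
  fix e :: "'b^'n" assume "e \<in> Basis"
  then obtain u i where e: "e = axis i u" "u \<in> Basis"
    by (auto simp: Basis_vec_def)
  show "(\<lambda>\<omega>. Z \<omega> \<bullet> e) \<in> borel_measurable N"
    unfolding e inner_axis using assms by measurable
qed

lemma borel_measurable_vec_nth:
  fixes Z :: "'a \<Rightarrow> 'b::euclidean_space^'n"
  assumes "Z \<in> borel_measurable N"
  shows "(\<lambda>\<omega>. Z \<omega> $ i) \<in> borel_measurable N"
  by (rule borel_measurable_continuous_on[OF _ assms]) (intro continuous_intros)

lemma borel_measurable_matrix_vector_mult: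
  fixes Z :: "'a \<Rightarrow> real^'n" and A :: "'a \<Rightarrow> real^'n^'m"
  assumes "A \<in> borel_measurable N" "Z \<in> borel_measurable N"
  shows "(\<lambda>\<omega>. A \<omega> *v Z \<omega>) \<in> borel_measurable N"
  using assms by (intro borel_measurable_vecI)
    (auto simp: matrix_vector_mult_def intro!: borel_measurable_sum borel_measurable_times borel_measurable_vec_nth)

lemma borel_measurable_frame_projection:
  fixes v :: "'a \<Rightarrow> real^'n" and Q :: "'a \<Rightarrow> real^'d^'n"
  assumes "v \<in> borel_measurable N" "Q \<in> borel_measurable N"
  shows "(\<lambda>\<omega>. aligned_frame (v \<omega>) (Q \<omega>) ** transpose (aligned_frame (v \<omega>) (Q \<omega>))) \<in> borel_measurable N"
proof -
  have "(\<lambda>\<omega>. sgn (v \<omega>)) \<in> borel_measurable N"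
    using assms(1) by measurable
  then show ?thesis
    unfolding aligned_frame_mult_transpose using assms(2)
    by (intro borel_measurable_vecI)
      (auto simp: outer_def matrix_matrix_mult_def transpose_def
        intro!: borel_measurable_add borel_measurable_sum borel_measurable_times borel_measurable_vec_nth)
qed

lemma continuous_bounded_on_balls:
  fixes h :: "'b::euclidean_space \<Rightarrow> 'c::real_normed_vector"
  assumes "continuous_on UNIV h"
  obtains K' where "\<And>y. norm y \<le> K \<Longrightarrow> norm (h y) \<le> K'"
proof -
  have "compact (h ` cball 0 K)"
    by (intro compact_continuous_image continuous_on_subset[OF assms]) auto
  then obtain K' where "\<forall>y\<in>h ` cball 0 K. norm y \<le> K'"
    using compact_imp_bounded bounded_iff by metis
  then have "norm (h y) \<le> K'" if "norm y \<le> K" for y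
    using that by simp
  then show thesis
    by (rule that)
qed

section \<open>Integrability and conditionally sampled batches\<close>

context prob_space
begin

lemma integrable_continuous_bounded:
  fixes Z :: "'a \<Rightarrow> 'b::euclidean_space" and h :: "'b \<Rightarrow> 'c::{banach, second_countable_topology}"
  assumes Z: "Z \<in> borel_measurable M" and K: "AE \<omega> in M. norm (Z \<omega>) \<le> K"
    and h: "continuous_on UNIV h"
  shows "integrable M (\<lambda>\<omega>. h (Z \<omega>))"
proof -
  obtain K' where K': "\<And>y. norm y \<le> K \<Longrightarrow> norm (h y) \<le> K'"
    using continuous_bounded_on_balls[OF h] by blast
  have "AE \<omega> in M. norm (h (Z \<omega>)) \<le> K'"
    using K by eventually_elim (rule K')
  then show ?thesis
    using borel_measurable_continuous_on[OF h Z] by (rule integrable_const_bound)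
qed

lemma sigma_finite_subalgebra:
  assumes "subalgebra M N"
  shows "sigma_finite_subalgebra M N"
proof -
  interpret finite_measure_subalgebra M N
    by unfold_locales (fact assms)
  show ?thesis ..
qed

text \<open>Integrating the conditional probability shows that a list outside the support is drawn
  with probability zero. There are only countably many lists, so the exceptional null sets can be
  united.\<close>

lemma sampled_batch_support:
  assumes N: "subalgebra M N" and B: "sampled_batch M N n (\<lambda>_. m) B"
  shows "AE \<omega> in M. B \<omega> \<in> set_pmf (batch_pmf n m)"
proof -
  interpret sigma_finite_subalgebra M N
    using N by (rule sigma_finite_subalgebra)
  have [measurable]: "B \<in> M \<rightarrow>\<^sub>M count_space UNIV"
    using B by (simp add: sampled_batch_def)
  have "AE \<omega> in M. B \<omega> \<noteq> b" if "b \<notin> set_pmf (batch_pmf n m)" for b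
  proof -
    have [measurable]: "{\<omega> \<in> space M. B \<omega> = b} \<in> sets M"
      by measurable
    have "prob {\<omega> \<in> space M. B \<omega> = b} = (\<integral>\<omega>. indicator {\<omega> \<in> space M. B \<omega> = b} \<omega> \<partial>M)"
      by simp
    also have "\<dots> = (\<integral>\<omega>. real_cond_exp M N (indicator {\<omega> \<in> space M. B \<omega> = b}) \<omega> \<partial>M)"
      by (intro real_cond_exp_int(2)[symmetric] integrable_real_indicator) (auto simp: less_top[symmetric])
    also have "\<dots> = (\<integral>\<omega>. pmf (batch_pmf n m) b \<partial>M)"
      using B by (intro integral_cong_AE) (auto simp: sampled_batch_def)
    also have "\<dots> = 0"
      using that by (simp add: set_pmf_iff)
    finally show ?thesis
      by (simp add: prob_Collect_eq_0)
  qed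
  then have "AE \<omega> in M. \<forall>b. b \<notin> set_pmf (batch_pmf n m) \<longrightarrow> B \<omega> \<noteq> b"
    unfolding AE_all_countable by auto
  then show ?thesis
    by eventually_elim auto
qed

text \<open>Split Y over the finitely many values b of the batch. Each \<open>\<phi> b\<close> is
  known to N, so conditioning on N replaces the indicator of B = b by the probability of b. The
  bound K supplies integrability.\<close>

lemma expectation_sampled_batch:
  fixes \<phi> :: "nat list \<Rightarrow> 'a \<Rightarrow> real"
  assumes N: "subalgebra M N" and B: "sampled_batch M N n (\<lambda>_. m) B" and "n \<ge> 1"
    and Y: "Y \<in> borel_measurable M" "AE \<omega> in M. Y \<omega> = \<phi> (B \<omega>) \<omega>"
    and meas: "\<And>b. b \<in> set_pmf (batch_pmf n m) \<Longrightarrow> \<phi> b \<in> borel_measurable N"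
    and bound: "\<And>b. b \<in> set_pmf (batch_pmf n m) \<Longrightarrow> AE \<omega> in M. \<bar>\<phi> b \<omega>\<bar> \<le> K"
  shows "expectation Y = expectation (\<lambda>\<omega>. measure_pmf.expectation (batch_pmf n m) (\<lambda>b. \<phi> b \<omega>))"
    and "integrable M (\<lambda>\<omega>. measure_pmf.expectation (batch_pmf n m) (\<lambda>b. \<phi> b \<omega>))"
proof -
  interpret sigma_finite_subalgebra M N
    using N by (rule sigma_finite_subalgebra)
  let ?p = "batch_pmf n m"
  let ?S = "set_pmf ?p"
  let ?I = "\<lambda>b. indicator {\<omega> \<in> space M. B \<omega> = b} :: 'a \<Rightarrow> real"
  have [measurable]: "B \<in> M \<rightarrow>\<^sub>M count_space UNIV"
    using B by (simp add: sampled_batch_def)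
  have S: "finite ?S"
    using \<open>n \<ge> 1\<close> by (rule finite_set_batch_pmf)
  have ev [measurable]: "{\<omega> \<in> space M. B \<omega> = b} \<in> sets M" for b
    by measurable
  have \<phi>M: "\<phi> b \<in> borel_measurable M" if "b \<in> ?S" for b
    using measurable_from_subalg[OF N meas[OF that]] .
  have \<phi>: "integrable M (\<phi> b)" if "b \<in> ?S" for b
    using bound[OF that] \<phi>M[OF that] by (intro integrable_const_bound) auto
  have int: "integrable M (\<lambda>\<omega>. \<phi> b \<omega> * ?I b \<omega>)" if "b \<in> ?S" for b
    using integrable_real_mult_indicator[OF ev \<phi>[OF that]] by (simp add: mult.commute)
  have pE: "measure_pmf.expectation ?p (\<lambda>b. \<phi> b \<omega>) = (\<Sum>b\<in>?S. pmf ?p b * \<phi> b \<omega>)" for \<omega>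
    using S by (subst integral_measure_pmf[of ?S]) auto
  have single: "(\<integral>\<omega>. \<phi> b \<omega> * ?I b \<omega> \<partial>M) = pmf ?p b * expectation (\<phi> b)" if "b \<in> ?S" for b
  proof -
    have "(\<integral>\<omega>. \<phi> b \<omega> * ?I b \<omega> \<partial>M) = (\<integral>\<omega>. \<phi> b \<omega> * real_cond_exp M N (?I b) \<omega> \<partial>M)"
      using real_cond_exp_intg(2)[OF int[OF that] meas[OF that]] by simp
    also have "\<dots> = (\<integral>\<omega>. \<phi> b \<omega> * pmf ?p b \<partial>M)"
    proof (rule integral_cong_AE)
      show "AE \<omega> in M. \<phi> b \<omega> * real_cond_exp M N (?I b) \<omega> = \<phi> b \<omega> * pmf ?p b"
        using B unfolding sampled_batch_def by auto
    qed (use \<phi>M[OF that] in auto)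
    finally show ?thesis
      by (simp add: mult.commute)
  qed
  have "expectation Y = (\<integral>\<omega>. (\<Sum>b\<in>?S. \<phi> b \<omega> * ?I b \<omega>) \<partial>M)"
  proof (rule integral_cong_AE)
    show "AE \<omega> in M. Y \<omega> = (\<Sum>b\<in>?S. \<phi> b \<omega> * ?I b \<omega>)"
      using sampled_batch_support[OF N B] Y(2) AE_space
    proof eventually_elim
      case (elim \<omega>)
      have "(\<Sum>b\<in>?S. \<phi> b \<omega> * ?I b \<omega>) = (\<Sum>b\<in>?S. if b = B \<omega> then \<phi> b \<omega> else 0)"
        using elim by (intro sum.cong) auto
      then show ?case
        using elim S by simp
    qed
  qed (use Y \<phi>M in auto)
  also have "\<dots> = (\<Sum>b\<in>?S. pmf ?p b * expectation (\<phi> b))"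
    using int single by (subst Bochner_Integration.integral_sum) auto
  also have "\<dots> = expectation (\<lambda>\<omega>. measure_pmf.expectation ?p (\<lambda>b. \<phi> b \<omega>))"
    unfolding pE using \<phi> by (subst Bochner_Integration.integral_sum) auto
  finally show "expectation Y = expectation (\<lambda>\<omega>. measure_pmf.expectation ?p (\<lambda>b. \<phi> b \<omega>))" .
  show "integrable M (\<lambda>\<omega>. measure_pmf.expectation ?p (\<lambda>b. \<phi> b \<omega>))"
    unfolding pE using \<phi> by auto
qed

end

subsection \<open>Runs of the algorithm\<close>

text \<open>The inequality ln x \<le> x - 1 at x = n / (n + 1) gives 1 / (n + 1) \<le> ln (n + 1) -
  ln n, which telescopes.\<close>

lemma harmonic_sum_le:
  assumes "n \<ge> 1"
  shows "(\<Sum>j=1..n. 1 / real j) \<le> 1 + ln (real n)"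
  using assms
proof (induction n rule: dec_induct)
  case (step n)
  have "ln (real n / real (Suc n)) \<le> real n / real (Suc n) - 1"
    using step by (intro ln_le_minus_one) auto
  then have "1 / real (Suc n) \<le> ln (real (Suc n)) - ln (real n)"
    using step by (simp add: ln_div field_simps)
  then show ?case
    using step by simp
qed simp

text \<open>A run together with the standing assumptions on the problem; \<open>fl\<close> is a
  lower bound at which the total decrease must stop. In this context \<open>'a\<close> is the sample
  space, \<open>'b\<close> indexes the n coordinates and \<open>'c\<close> the d random
  columns.\<close>

locale smooth_ssgdpm = ssgdpm +
  fixes fl :: real
  assumes M: "M \<ge> 1" and m: "m \<ge> 1" and L: "L > 0" and k0: "k\<^sub>0 > 0"
    and smooth: "\<forall>i\<in>{1..M}. L_smooth L (f i)"
    and lower: "\<And>x. fl \<le> objective M f x"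
    and var: "variance_bound M f \<sigma>\<^sub>1"
begin

abbreviation "obj \<equiv> objective M f"
abbreviation "g \<equiv> grad obj"

text \<open>The projection used in passing from \<open>X j\<close> to \<open>X (Suc j)\<close>.
  Steps are indexed by j = k - 1 from here on, hence the recurring premise
  \<open>k\<^sub>0 \<le> Suc j\<close>.\<close>

definition A :: "nat \<Rightarrow> 'a \<Rightarrow> real^'b^'b" where
  "A j \<omega> = aligned_frame (V j \<omega>) (Pt j \<omega>) ** transpose (aligned_frame (V j \<omega>) (Pt j \<omega>))"

lemma obj_smooth: "L_smooth L obj"
  using smooth L by (intro L_smooth_objective) auto

section \<open>Measurability along a run\<close>

lemma subalg:
  assumes "k\<^sub>0 \<le> Suc j"
  shows "subalgebra \<Omega> (F j)" "subalgebra (H j) (G j)" "subalgebra (G j) (F j)"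
    "subalgebra \<Omega> (H j)" "subalgebra \<Omega> (G j)"
  using filtration[OF assms] by (auto simp: subalgebra_def)

lemma F_to_G: "k\<^sub>0 \<le> Suc j \<Longrightarrow> Z \<in> borel_measurable (F j) \<Longrightarrow> Z \<in> borel_measurable (G j)"
  using subalg measurable_from_subalg by blast

lemma G_to_H: "k\<^sub>0 \<le> Suc j \<Longrightarrow> Z \<in> borel_measurable (G j) \<Longrightarrow> Z \<in> borel_measurable (H j)"
  using subalg measurable_from_subalg by blast

lemma measurable_states:
  assumes "k\<^sub>0 \<le> Suc j"
  shows "X j \<in> borel_measurable \<Omega>" "X j \<in> borel_measurable (G j)" "X j \<in> borel_measurable (H j)"
    "V j \<in> borel_measurable (G j)" "V j \<in> borel_measurable (H j)" "Pt j \<in> borel_measurable (H j)"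
proof -
  have X: "X j \<in> borel_measurable (F j)"
    using X_measurable[OF assms] by simp
  then show "X j \<in> borel_measurable \<Omega>"
    using subalg(1)[OF assms] measurable_from_subalg by blast
  show "X j \<in> borel_measurable (G j)"
    using X assms by (intro F_to_G)
  then show "X j \<in> borel_measurable (H j)"
    using assms by (intro G_to_H)
  show "V j \<in> borel_measurable (G j)"
    using V_measurable[OF assms] by simp
  then show "V j \<in> borel_measurable (H j)"
    using assms by (intro G_to_H)
  show "Pt j \<in> borel_measurable (H j)"
    using Pt_measurable[OF assms] by simp
qed

lemma A_measurable: "k\<^sub>0 \<le> Suc j \<Longrightarrow> A j \<in> borel_measurable (H j)"
  unfolding A_def[abs_def] by (intro borel_measurable_frame_projection measurable_states)

lemma AE_frame:
  assumes "k\<^sub>0 \<le> Suc j"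
  shows "AE \<omega> in \<Omega>. transpose (aligned_frame (V j \<omega>) (Pt j \<omega>)) ** aligned_frame (V j \<omega>) (Pt j \<omega>) = mat 1"
  using V_nonzero[OF assms] Pt_orthogonal[OF assms] Pt_orthonormal[OF assms]
  by eventually_elim (simp add: aligned_frame_orthonormal)

text \<open>The d + 1 columns are almost surely orthonormal, and an almost sure property cannot fail
  everywhere. Hence n - 1 \<ge> d \<ge> 1, which makes the factor d / (n - 1) meaningful and at most
  1.\<close>

lemma frame_dimension: "CARD('c) + 1 \<le> CARD('b)"
proof (rule ccontr)
  assume neg: "\<not> CARD('c) + 1 \<le> CARD('b)"
  have "AE \<omega> in \<Omega>. False"
    using AE_frame[OF le_SucI[OF order_refl]]
  proof eventually_elim
    case (elim \<omega>)
    then show ?case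
      using frame_card_le neg by fastforce
  qed
  then show False
    by simp
qed

section \<open>The update rule, boundedness and integrability of the iterates\<close>

lemma AE_batch:
  assumes "k\<^sub>0 \<le> Suc j"
  shows "AE \<omega> in \<Omega>. B j \<omega> \<in> set_pmf (batch_pmf M m)"
  using sampled_batch_support[OF subalg(4)[OF assms]] batch[OF assms] by simp

text \<open>The algorithm projects every sampled gradient separately; by linearity this is the
  projection of the batch gradient, as the batch has length m almost surely.\<close>

lemma AE_step:
  assumes "k\<^sub>0 \<le> Suc j"
  shows "AE \<omega> in \<Omega>. X (Suc j) \<omega> = X j \<omega> - step_size L j *\<^sub>R (A j \<omega> *v batch_grad f (B j \<omega>) (X j \<omega>))"
  using step[OF assms] AE_batch[OF assms]
proof eventually_elim
  case (elim \<omega>)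
  then have "length (B j \<omega>) = m"
    using set_batch_pmf[OF M] by blast
  then show ?case
    using elim
    by (simp add: Let_def sum_list_matrix_vector batch_grad_def A_def matrix_vector_mult_scaleR)
qed

text \<open>The bound covers all batches of the support at once, not just the one drawn, because the
  conditional expectation evaluates the objective at every such update.\<close>

lemma AE_update_bounded:
  assumes j: "k\<^sub>0 \<le> Suc j" and K: "AE \<omega> in \<Omega>. norm (X j \<omega>) \<le> K"
  obtains K' where "AE \<omega> in \<Omega>. \<forall>b\<in>set_pmf (batch_pmf M m).
      norm (X j \<omega> - step_size L j *\<^sub>R (A j \<omega> *v batch_grad f b (X j \<omega>))) \<le> K'"
proof -
  let ?C = "\<Sum>i=1..M. norm (grad (f i) 0)"
  have "AE \<omega> in \<Omega>. \<forall>b\<in>set_pmf (batch_pmf M m).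
      norm (X j \<omega> - step_size L j *\<^sub>R (A j \<omega> *v batch_grad f b (X j \<omega>)))
        \<le> K + \<bar>step_size L j\<bar> * (?C + L * K)"
    using K AE_frame[OF j]
  proof (eventually_elim, intro ballI)
    fix \<omega> b
    assume X: "norm (X j \<omega>) \<le> K" and b: "b \<in> set_pmf (batch_pmf M m)"
      and P: "transpose (aligned_frame (V j \<omega>) (Pt j \<omega>)) ** aligned_frame (V j \<omega>) (Pt j \<omega>) = mat 1"
    have "norm (A j \<omega> *v batch_grad f b (X j \<omega>)) \<le> norm (batch_grad f b (X j \<omega>))"
      unfolding A_def using P by (rule norm_frame_projection)
    also have "\<dots> \<le> ?C + L * norm (X j \<omega>)"
      using b m L smooth set_batch_pmf[OF M] by (intro norm_batch_grad_le) auto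
    also have "\<dots> \<le> ?C + L * K"
      using X L by simp
    finally have "norm (step_size L j *\<^sub>R (A j \<omega> *v batch_grad f b (X j \<omega>)))
        \<le> \<bar>step_size L j\<bar> * (?C + L * K)"
      by (simp add: mult_left_mono)
    then show "norm (X j \<omega> - step_size L j *\<^sub>R (A j \<omega> *v batch_grad f b (X j \<omega>)))
        \<le> K + \<bar>step_size L j\<bar> * (?C + L * K)"
      using X norm_triangle_ineq4[of "X j \<omega>" "step_size L j *\<^sub>R (A j \<omega> *v batch_grad f b (X j \<omega>))"]
      by linarith
  qed
  then show thesis
    by (rule that)
qed

text \<open>The start is deterministic and one step enlarges the norm by at most an affine function
  of it, so each iterate is almost surely bounded by a constant depending on j. Continuous functions
  of \<open>X j\<close> are thus integrable.\<close>

lemma X_bounded: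
  assumes "k\<^sub>0 \<le> Suc j"
  shows "\<exists>K. AE \<omega> in \<Omega>. norm (X j \<omega>) \<le> K"
proof -
  have "k\<^sub>0 - 1 \<le> j"
    using assms by simp
  then show ?thesis
  proof (induction j rule: dec_induct)
    case base
    have "AE \<omega> in \<Omega>. norm (X (k\<^sub>0 - 1) \<omega>) \<le> norm x\<^sub>0"
      using start by eventually_elim simp
    then show ?case ..
  next
    case (step j)
    then obtain K where K: "AE \<omega> in \<Omega>. norm (X j \<omega>) \<le> K"
      by blast
    have j: "k\<^sub>0 \<le> Suc j"
      using step by simp
    obtain K' where "AE \<omega> in \<Omega>. \<forall>b\<in>set_pmf (batch_pmf M m).
        norm (X j \<omega> - step_size L j *\<^sub>R (A j \<omega> *v batch_grad f b (X j \<omega>))) \<le> K'"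
      using AE_update_bounded[OF j K] .
    then have "AE \<omega> in \<Omega>. norm (X (Suc j) \<omega>) \<le> K'"
      using AE_step[OF j] AE_batch[OF j] by eventually_elim simp
    then show ?case ..
  qed
qed

lemma integrable_X:
  fixes h :: "real^'b \<Rightarrow> 'e::{banach, second_countable_topology}"
  assumes "k\<^sub>0 \<le> Suc j" "continuous_on UNIV h"
  shows "integrable \<Omega> (\<lambda>\<omega>. h (X j \<omega>))"
  using X_bounded[OF assms(1)] measurable_states(1)[OF assms(1)] assms(2)
  by (auto intro: integrable_continuous_bounded)

lemma integrable_obj: "k\<^sub>0 \<le> Suc j \<Longrightarrow> integrable \<Omega> (\<lambda>\<omega>. obj (X j \<omega>))"
  by (intro integrable_X L_smooth_continuous[OF obj_smooth])

lemma integrable_grad_sq: "k\<^sub>0 \<le> Suc j \<Longrightarrow> integrable \<Omega> (\<lambda>\<omega>. (norm (g (X j \<omega>)))\<^sup>2)"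
  by (intro integrable_X continuous_intros L_smooth_continuous[OF obj_smooth])

lemma integrable_proj_sq:
  assumes j: "k\<^sub>0 \<le> Suc j"
  shows "integrable \<Omega> (\<lambda>\<omega>. (norm (A j \<omega> *v g (X j \<omega>)))\<^sup>2)"
proof (rule Bochner_Integration.integrable_bound[OF integrable_grad_sq[OF j]])
  have "A j \<in> borel_measurable \<Omega>"
    using A_measurable[OF j] subalg(4)[OF j] measurable_from_subalg by blast
  moreover have "(\<lambda>\<omega>. g (X j \<omega>)) \<in> borel_measurable \<Omega>"
    using L_smooth_continuous(2)[OF obj_smooth] measurable_states(1)[OF j]
    by (rule borel_measurable_continuous_on)
  ultimately have "(\<lambda>\<omega>. A j \<omega> *v g (X j \<omega>)) \<in> borel_measurable \<Omega>"
    by (rule borel_measurable_matrix_vector_mult)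
  then show "(\<lambda>\<omega>. (norm (A j \<omega> *v g (X j \<omega>)))\<^sup>2) \<in> borel_measurable \<Omega>"
    by measurable
  show "AE \<omega> in \<Omega>. norm ((norm (A j \<omega> *v g (X j \<omega>)))\<^sup>2) \<le> norm ((norm (g (X j \<omega>)))\<^sup>2)"
    using AE_frame[OF j]
    by eventually_elim (simp add: A_def norm_frame_projection(2) power_mono)
qed

section \<open>Conditional mean of the projected gradient\<close>

text \<open>Replacing \<open>Pt Pt\<^sup>T\<close> by its conditional mean leaves
  \<open>\<rho> \<parallel>u\<parallel>\<^sup>2 + (1 - \<rho>) (s \<bullet> u)\<^sup>2\<close> with \<open>\<rho> = d / (n - 1) \<le> 1\<close>, where \<open>u\<close> is the gradient and
  \<open>s\<close> the normalised alignment vector; the alignment term is then dropped.\<close>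

lemma projected_gradient_lower_bound:
  assumes j: "k\<^sub>0 \<le> Suc j"
  shows "(\<integral>\<omega>. (norm (g (X j \<omega>)))\<^sup>2 \<partial>\<Omega>) / real CARD('b)
    \<le> (\<integral>\<omega>. (norm (A j \<omega> *v g (X j \<omega>)))\<^sup>2 \<partial>\<Omega>)"
proof -
  interpret G: sigma_finite_subalgebra \<Omega> "G j"
    using subalg(5)[OF j] by (rule sigma_finite_subalgebra)
  define \<rho> where "\<rho> = real CARD('c) / (real CARD('b) - 1)"
  have dim: "real CARD('c) + 1 \<le> real CARD('b)" "real CARD('c) \<ge> 1"
    using frame_dimension by (simp_all flip: of_nat_Suc)
  then have \<rho>: "\<rho> \<le> 1"
    unfolding \<rho>_def by (intro divide_le_eq_1_pos[THEN iffD2]) linarith+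
  \<comment> \<open>From d \<ge> 1 and n - 1 \<le> n. This is the source of the factor 1 / n in the
    final rate.\<close>
  have \<rho>_ge: "1 / real CARD('b) \<le> \<rho>"
    unfolding \<rho>_def using dim by (intro frac_le) linarith+
  define u where "u \<omega> = g (X j \<omega>)" for \<omega>
  define s where "s \<omega> = sgn (V j \<omega>)" for \<omega>
  define Q where "Q i l \<omega> = (Pt j \<omega> ** transpose (Pt j \<omega>)) $ i $ l" for i l \<omega>
  define R where "R i l \<omega> = \<rho> * ((if i = l then 1 else 0) - s \<omega> $ i * s \<omega> $ l)" for i l \<omega>
  have uG: "u \<in> borel_measurable (G j)"
    unfolding u_def using L_smooth_continuous(2)[OF obj_smooth] measurable_states(2)[OF j]
    by (rule borel_measurable_continuous_on)
  have sG: "s \<in> borel_measurable (G j)"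
    unfolding s_def using measurable_states(4)[OF j] by measurable
  have uuG: "(\<lambda>\<omega>. u \<omega> $ i * u \<omega> $ l) \<in> borel_measurable (G j)" for i l
    by (intro borel_measurable_times borel_measurable_vec_nth uG)
  have RG: "R i l \<in> borel_measurable (G j)" for i l
    unfolding R_def by (intro borel_measurable_times borel_measurable_diff borel_measurable_vec_nth sG) auto
  have QH: "Q i l \<in> borel_measurable (H j)" for i l
    unfolding Q_def matrix_matrix_mult_def transpose_def using measurable_states(6)[OF j]
    by (auto intro!: borel_measurable_sum borel_measurable_times borel_measurable_vec_nth)
  note from_G = measurable_from_subalg[OF subalg(5)[OF j]]
  note from_H = measurable_from_subalg[OF subalg(4)[OF j]]
  have uu_int: "integrable \<Omega> (\<lambda>\<omega>. u \<omega> $ i * u \<omega> $ l)" for i l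
    unfolding u_def using j
    by (intro integrable_X continuous_intros L_smooth_continuous(2)[OF obj_smooth])
  \<comment> \<open>The entries of a unit column are at most 1 in modulus, and each entry of the
    product is a sum of d terms. Boundedness makes the products with the gradient entries
    integrable.\<close>
  have Q_bound: "AE \<omega> in \<Omega>. \<bar>Q i l \<omega>\<bar> \<le> real CARD('c)" for i l
    using Pt_orthonormal[OF j]
  proof eventually_elim
    case (elim \<omega>)
    have c: "\<bar>Pt j \<omega> $ i $ e\<bar> \<le> 1" for i e
    proof -
      have "column e (Pt j \<omega>) \<bullet> column e (Pt j \<omega>) = 1"
        using elim by (simp add: matrix_mult_transpose_dot_column mat_def vec_eq_iff)
      then have "norm (column e (Pt j \<omega>)) = 1"
        by (simp add: norm_eq_1)
      then show ?thesis
        using component_le_norm_cart[of "column e (Pt j \<omega>)" i] by (simp add: column_def)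
    qed
    have "\<bar>Q i l \<omega>\<bar> \<le> (\<Sum>e\<in>(UNIV :: 'c set). \<bar>Pt j \<omega> $ i $ e * Pt j \<omega> $ l $ e\<bar>)"
      unfolding Q_def by (simp add: matrix_matrix_mult_def transpose_def)
    also have "\<dots> \<le> (\<Sum>e\<in>(UNIV :: 'c set). 1)"
      using c by (intro sum_mono) (simp add: abs_mult mult_le_one)
    finally show ?case by simp
  qed
  have Q_int: "integrable \<Omega> (\<lambda>\<omega>. u \<omega> $ i * u \<omega> $ l * Q i l \<omega>)" for i l
  proof (rule Bochner_Integration.integrable_bound)
    show "integrable \<Omega> (\<lambda>\<omega>. real CARD('c) * (u \<omega> $ i * u \<omega> $ l))"
      using uu_int by simp
    show "(\<lambda>\<omega>. u \<omega> $ i * u \<omega> $ l * Q i l \<omega>) \<in> borel_measurable \<Omega>"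
      using from_G[OF uuG] from_H[OF QH] by (rule borel_measurable_times)
    show "AE \<omega> in \<Omega>. norm (u \<omega> $ i * u \<omega> $ l * Q i l \<omega>) \<le> norm (real CARD('c) * (u \<omega> $ i * u \<omega> $ l))"
      using Q_bound[of i l]
      by eventually_elim (simp add: abs_mult mult.commute[of "real CARD('c)"] mult_left_mono)
  qed
  have cond: "AE \<omega> in \<Omega>. real_cond_exp \<Omega> (G j) (Q i l) \<omega> = R i l \<omega>" for i l
    using Pt_moment[OF j, of i l] unfolding Q_def R_def \<rho>_def s_def
    by (simp add: mat_def outer_def)
  \<comment> \<open>The gradient entries are known to \<open>G j\<close>, so under the integral only
    Q is replaced by its conditional mean R. The argument goes entry by entry because the
    conditional expectation is real-valued.\<close>
  have QR: "(\<integral>\<omega>. u \<omega> $ i * u \<omega> $ l * Q i l \<omega> \<partial>\<Omega>) = (\<integral>\<omega>. u \<omega> $ i * u \<omega> $ l * R i l \<omega> \<partial>\<Omega>)"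
    and R_int: "integrable \<Omega> (\<lambda>\<omega>. u \<omega> $ i * u \<omega> $ l * R i l \<omega>)" for i l
  proof -
    note eq = G.real_cond_exp_intg[OF Q_int uuG from_H[OF QH]]
    have ae: "AE \<omega> in \<Omega>. u \<omega> $ i * u \<omega> $ l * real_cond_exp \<Omega> (G j) (Q i l) \<omega> = u \<omega> $ i * u \<omega> $ l * R i l \<omega>"
      using cond[of i l] by eventually_elim simp
    have meas: "(\<lambda>\<omega>. u \<omega> $ i * u \<omega> $ l * R i l \<omega>) \<in> borel_measurable \<Omega>"
      using from_G[OF uuG] from_G[OF RG] by (rule borel_measurable_times)
    show "(\<integral>\<omega>. u \<omega> $ i * u \<omega> $ l * Q i l \<omega> \<partial>\<Omega>) = (\<integral>\<omega>. u \<omega> $ i * u \<omega> $ l * R i l \<omega> \<partial>\<Omega>)"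
      unfolding eq(2)[symmetric] using ae meas eq(1)[THEN borel_measurable_integrable]
      by (intro integral_cong_AE)
    show "integrable \<Omega> (\<lambda>\<omega>. u \<omega> $ i * u \<omega> $ l * R i l \<omega>)"
      using eq(1) meas ae by (rule integrable_cong_AE_imp)
  qed
  have R_sum: "(\<Sum>i\<in>UNIV. \<Sum>l\<in>UNIV. u \<omega> $ i * u \<omega> $ l * R i l \<omega>)
      = \<rho> * ((norm (u \<omega>))\<^sup>2 - (s \<omega> \<bullet> u \<omega>)\<^sup>2)" for \<omega>
  proof -
    have "(\<Sum>i\<in>UNIV. \<Sum>l\<in>UNIV. u \<omega> $ i * u \<omega> $ l * R i l \<omega>)
        = \<rho> * ((\<Sum>i\<in>UNIV. \<Sum>l\<in>UNIV. if i = l then u \<omega> $ i * u \<omega> $ l else 0)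
            - (\<Sum>i\<in>UNIV. \<Sum>l\<in>UNIV. (s \<omega> $ i * u \<omega> $ i) * (s \<omega> $ l * u \<omega> $ l)))"
      unfolding sum_subtractf[symmetric] sum_distrib_left R_def
      by (intro sum.cong refl) (simp add: algebra_simps)
    also have "\<dots> = \<rho> * ((norm (u \<omega>))\<^sup>2 - (s \<omega> \<bullet> u \<omega>)\<^sup>2)"
      unfolding power2_norm_eq_inner by (simp add: inner_vec_def power2_eq_square sum_product)
    finally show ?thesis .
  qed
  have s_int: "integrable \<Omega> (\<lambda>\<omega>. (s \<omega> \<bullet> u \<omega>)\<^sup>2)"
  proof (rule Bochner_Integration.integrable_bound)
    show "integrable \<Omega> (\<lambda>\<omega>. (norm (u \<omega>))\<^sup>2)"
      unfolding u_def using j by (rule integrable_grad_sq)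
    show "(\<lambda>\<omega>. (s \<omega> \<bullet> u \<omega>)\<^sup>2) \<in> borel_measurable \<Omega>"
      using from_G[OF uG] from_G[OF sG] by measurable
    \<comment> \<open>This holds at every outcome, including those with a zero alignment vector,
      since \<open>sgn 0 = 0\<close>.\<close>
    have "\<bar>s \<omega> \<bullet> u \<omega>\<bar> \<le> norm (u \<omega>)" for \<omega>
      using Cauchy_Schwarz_ineq2[of "s \<omega>" "u \<omega>"] mult_right_mono[of "norm (s \<omega>)" 1 "norm (u \<omega>)"]
      by (simp add: s_def norm_sgn split: if_splits)
    then show "AE \<omega> in \<Omega>. norm ((s \<omega> \<bullet> u \<omega>)\<^sup>2) \<le> norm ((norm (u \<omega>))\<^sup>2)"
      by (simp add: abs_le_square_iff[symmetric])
  qed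
  have "AE \<omega> in \<Omega>. (norm (A j \<omega> *v u \<omega>))\<^sup>2
      = (s \<omega> \<bullet> u \<omega>)\<^sup>2 + (\<Sum>i\<in>UNIV. \<Sum>l\<in>UNIV. u \<omega> $ i * u \<omega> $ l * Q i l \<omega>)"
    using AE_frame[OF j]
  proof eventually_elim
    case (elim \<omega>)
    have "(norm (A j \<omega> *v u \<omega>))\<^sup>2 = u \<omega> \<bullet> (A j \<omega> *v u \<omega>)"
      unfolding A_def using elim by (rule norm_frame_projection)
    also have "\<dots> = u \<omega> \<bullet> ((outer (s \<omega>) + Pt j \<omega> ** transpose (Pt j \<omega>)) *v u \<omega>)"
      by (simp add: A_def aligned_frame_mult_transpose s_def)
    also have "\<dots>
        = (\<Sum>i\<in>UNIV. \<Sum>l\<in>UNIV. (s \<omega> $ i * u \<omega> $ i) * (s \<omega> $ l * u \<omega> $ l) + u \<omega> $ i * u \<omega> $ l * Q i l \<omega>)"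
      unfolding inner_vec_def matrix_vector_mult_def Q_def outer_def
      by (simp add: sum_distrib_left algebra_simps)
    also have "\<dots> = (s \<omega> \<bullet> u \<omega>)\<^sup>2 + (\<Sum>i\<in>UNIV. \<Sum>l\<in>UNIV. u \<omega> $ i * u \<omega> $ l * Q i l \<omega>)"
      by (simp add: sum.distrib inner_vec_def power2_eq_square sum_product)
    finally show ?case .
  qed
  then have "(\<integral>\<omega>. (norm (A j \<omega> *v u \<omega>))\<^sup>2 \<partial>\<Omega>)
      = (\<integral>\<omega>. (s \<omega> \<bullet> u \<omega>)\<^sup>2 + (\<Sum>i\<in>UNIV. \<Sum>l\<in>UNIV. u \<omega> $ i * u \<omega> $ l * Q i l \<omega>) \<partial>\<Omega>)"
    using integrable_proj_sq[OF j, folded u_def] s_int Q_int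
    by (intro integral_cong_AE borel_measurable_integrable Bochner_Integration.integrable_add
        Bochner_Integration.integrable_sum)
  also have "\<dots> = (\<integral>\<omega>. (s \<omega> \<bullet> u \<omega>)\<^sup>2 \<partial>\<Omega>)
      + (\<Sum>i\<in>UNIV. \<Sum>l\<in>UNIV. \<integral>\<omega>. u \<omega> $ i * u \<omega> $ l * Q i l \<omega> \<partial>\<Omega>)"
    using s_int Q_int by simp
  also have "\<dots> = (\<integral>\<omega>. (s \<omega> \<bullet> u \<omega>)\<^sup>2 + (\<Sum>i\<in>UNIV. \<Sum>l\<in>UNIV. u \<omega> $ i * u \<omega> $ l * R i l \<omega>) \<partial>\<Omega>)"
    unfolding QR using s_int R_int by simp
  also have "\<dots> \<ge> (\<integral>\<omega>. (norm (u \<omega>))\<^sup>2 / real CARD('b) \<partial>\<Omega>)"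
  proof (rule integral_mono)
    show "integrable \<Omega> (\<lambda>\<omega>. (norm (u \<omega>))\<^sup>2 / real CARD('b))"
      using integrable_grad_sq[OF j] by (simp add: u_def)
    show "integrable \<Omega> (\<lambda>\<omega>. (s \<omega> \<bullet> u \<omega>)\<^sup>2 + (\<Sum>i\<in>UNIV. \<Sum>l\<in>UNIV. u \<omega> $ i * u \<omega> $ l * R i l \<omega>))"
      using s_int R_int by auto
    fix \<omega>
    have "1 / real CARD('b) * (norm (u \<omega>))\<^sup>2 \<le> \<rho> * (norm (u \<omega>))\<^sup>2"
      using \<rho>_ge by (intro mult_right_mono) auto
    moreover have "0 \<le> (1 - \<rho>) * (s \<omega> \<bullet> u \<omega>)\<^sup>2"
      using \<rho> by simp
    ultimately show "(norm (u \<omega>))\<^sup>2 / real CARD('b)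
        \<le> (s \<omega> \<bullet> u \<omega>)\<^sup>2 + (\<Sum>i\<in>UNIV. \<Sum>l\<in>UNIV. u \<omega> $ i * u \<omega> $ l * R i l \<omega>)"
      unfolding R_sum by (simp add: algebra_simps)
  qed
  finally show ?thesis
    by (simp add: u_def)
qed

text \<open>The batch is integrated out given \<open>H j\<close> by the one-step descent estimate,
  and the projected gradient is then bounded below in expectation. With the chosen step size, L *
  \<alpha>^2 / 2 equals 1 / (2 L (j + 1)), the source of the harmonic error term.\<close>

lemma expected_step:
  assumes j: "k\<^sub>0 \<le> Suc j"
  shows "(\<integral>\<omega>. obj (X (Suc j) \<omega>) \<partial>\<Omega>)
      + (\<integral>\<omega>. (norm (g (X j \<omega>)))\<^sup>2 \<partial>\<Omega>) / (2 * real CARD('b) * L * sqrt (real j + 1))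
    \<le> (\<integral>\<omega>. obj (X j \<omega>) \<partial>\<Omega>) + \<sigma>\<^sub>1\<^sup>2 / (2 * L * real m) * (1 / (real j + 1))"
proof -
  define \<alpha> where "\<alpha> = step_size L j"
  define \<phi> where "\<phi> b \<omega> = obj (X j \<omega> - \<alpha> *\<^sub>R (A j \<omega> *v batch_grad f b (X j \<omega>)))" for b \<omega>
  define a where "a = (\<integral>\<omega>. (norm (A j \<omega> *v g (X j \<omega>)))\<^sup>2 \<partial>\<Omega>)"
  obtain K where K: "AE \<omega> in \<Omega>. norm (X j \<omega>) \<le> K"
    using X_bounded[OF j] by blast
  obtain K' where K': "AE \<omega> in \<Omega>. \<forall>b\<in>set_pmf (batch_pmf M m).
      norm (X j \<omega> - \<alpha> *\<^sub>R (A j \<omega> *v batch_grad f b (X j \<omega>))) \<le> K'"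
    using AE_update_bounded[OF j K] unfolding \<alpha>_def by blast
  \<comment> \<open>The three constants bound in turn the iterate, all its possible updates and the
    objective there; the last one is the bound required to average over the batch.\<close>
  obtain K'' where K'': "\<And>y. norm y \<le> K' \<Longrightarrow> norm (obj y) \<le> K''"
    using continuous_bounded_on_balls[OF L_smooth_continuous(1)[OF obj_smooth]] by blast
  have eq: "(\<integral>\<omega>. obj (X (Suc j) \<omega>) \<partial>\<Omega>)
        = (\<integral>\<omega>. measure_pmf.expectation (batch_pmf M m) (\<lambda>b. \<phi> b \<omega>) \<partial>\<Omega>)"
    and int: "integrable \<Omega> (\<lambda>\<omega>. measure_pmf.expectation (batch_pmf M m) (\<lambda>b. \<phi> b \<omega>))"
  proof (atomize (full), intro conjI expectation_sampled_batch[OF subalg(4)[OF j] _ M])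
    show "sampled_batch \<Omega> (H j) M (\<lambda>_. m) (B j)"
      using batch[OF j] by simp
    then show "sampled_batch \<Omega> (H j) M (\<lambda>_. m) (B j)" .
    show Y: "(\<lambda>\<omega>. obj (X (Suc j) \<omega>)) \<in> borel_measurable \<Omega>"
      using j by (intro borel_measurable_integrable integrable_obj) simp
    then show "(\<lambda>\<omega>. obj (X (Suc j) \<omega>)) \<in> borel_measurable \<Omega>" .
    show "AE \<omega> in \<Omega>. obj (X (Suc j) \<omega>) = \<phi> (B j \<omega>) \<omega>"
      using AE_step[OF j] by eventually_elim (simp add: \<phi>_def \<alpha>_def)
    then show "AE \<omega> in \<Omega>. obj (X (Suc j) \<omega>) = \<phi> (B j \<omega>) \<omega>" .
    fix b assume b: "b \<in> set_pmf (batch_pmf M m)"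
    have "continuous_on UNIV (\<lambda>x. \<Sum>i\<leftarrow>b'. grad (f i) x)" if "set b' \<subseteq> {1..M}" for b'
      using that smooth
      by (induction b') (auto intro!: continuous_on_add L_smooth_continuous(2))
    then have "continuous_on UNIV (batch_grad f b)"
      using b unfolding batch_grad_def[abs_def] set_batch_pmf[OF M]
      by (auto intro!: continuous_on_scaleR)
    then have "(\<lambda>\<omega>. batch_grad f b (X j \<omega>)) \<in> borel_measurable (H j)"
      using measurable_states(3)[OF j] by (rule borel_measurable_continuous_on)
    with A_measurable[OF j] have "(\<lambda>\<omega>. A j \<omega> *v batch_grad f b (X j \<omega>)) \<in> borel_measurable (H j)"
      by (rule borel_measurable_matrix_vector_mult)
    then have "(\<lambda>\<omega>. X j \<omega> - \<alpha> *\<^sub>R (A j \<omega> *v batch_grad f b (X j \<omega>))) \<in> borel_measurable (H j)"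
      using measurable_states(3)[OF j] by measurable
    then show "\<phi> b \<in> borel_measurable (H j)"
      unfolding \<phi>_def[abs_def] by (rule borel_measurable_continuous_on[OF L_smooth_continuous(1)[OF obj_smooth]])
    then show "\<phi> b \<in> borel_measurable (H j)" .
    show "AE \<omega> in \<Omega>. \<bar>\<phi> b \<omega>\<bar> \<le> K''"
      using K' by eventually_elim (use b K'' in \<open>auto simp: \<phi>_def\<close>)
    then show "AE \<omega> in \<Omega>. \<bar>\<phi> b \<omega>\<bar> \<le> K''" .
  qed
  have \<alpha>: "\<alpha> = 1 / (L * sqrt (real j + 1))" "L * \<alpha>\<^sup>2 / 2 = 1 / (2 * L) * (1 / (real j + 1))" "\<alpha> \<ge> 0"
    using L by (simp_all add: \<alpha>_def step_size_def power_divide power_mult_distrib)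
      (simp add: power2_eq_square)
  \<comment> \<open>Since sqrt (j + 1) \<ge> 1, the step size never exceeds 1 / L, so at least half
    of the first-order decrease survives the quadratic term.\<close>
  have "L * \<alpha> \<le> 1"
    using L by (simp add: \<alpha>)
  then have "\<alpha> * (L * \<alpha>) \<le> \<alpha> * 1"
    using \<alpha>(3) by (rule mult_left_mono)
  then have half: "\<alpha> / 2 \<le> \<alpha> - L * \<alpha>\<^sup>2 / 2"
    by (simp add: power2_eq_square mult_ac)
  note ints = integrable_obj[OF j] integrable_proj_sq[OF j]
  have "(\<integral>\<omega>. measure_pmf.expectation (batch_pmf M m) (\<lambda>b. \<phi> b \<omega>) \<partial>\<Omega>)
      \<le> (\<integral>\<omega>. obj (X j \<omega>) - (\<alpha> - L * \<alpha>\<^sup>2 / 2) * (norm (A j \<omega> *v g (X j \<omega>)))\<^sup>2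
          + L * \<alpha>\<^sup>2 / 2 * (\<sigma>\<^sub>1\<^sup>2 / real m) \<partial>\<Omega>)"
  proof (rule integral_mono_AE[OF int])
    show "integrable \<Omega> (\<lambda>\<omega>. obj (X j \<omega>) - (\<alpha> - L * \<alpha>\<^sup>2 / 2) * (norm (A j \<omega> *v g (X j \<omega>)))\<^sup>2
        + L * \<alpha>\<^sup>2 / 2 * (\<sigma>\<^sub>1\<^sup>2 / real m))"
      using ints by simp
    show "AE \<omega> in \<Omega>. measure_pmf.expectation (batch_pmf M m) (\<lambda>b. \<phi> b \<omega>)
        \<le> obj (X j \<omega>) - (\<alpha> - L * \<alpha>\<^sup>2 / 2) * (norm (A j \<omega> *v g (X j \<omega>)))\<^sup>2
          + L * \<alpha>\<^sup>2 / 2 * (\<sigma>\<^sub>1\<^sup>2 / real m)"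
      using AE_frame[OF j] unfolding \<phi>_def A_def
      by eventually_elim (rule expected_descent_step[OF M m _ smooth var], use L in auto)
  qed
  also have "\<dots> = (\<integral>\<omega>. obj (X j \<omega>) \<partial>\<Omega>) - (\<alpha> - L * \<alpha>\<^sup>2 / 2) * a + L * \<alpha>\<^sup>2 / 2 * (\<sigma>\<^sub>1\<^sup>2 / real m)"
    using ints by (simp add: a_def prob_space)
  also have "\<dots> \<le> (\<integral>\<omega>. obj (X j \<omega>) \<partial>\<Omega>) - \<alpha> / 2 * a + L * \<alpha>\<^sup>2 / 2 * (\<sigma>\<^sub>1\<^sup>2 / real m)"
    using half by (intro add_right_mono diff_left_mono mult_right_mono) (auto simp: a_def)
  also have "\<dots> \<le> (\<integral>\<omega>. obj (X j \<omega>) \<partial>\<Omega>)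
      - \<alpha> / 2 * ((\<integral>\<omega>. (norm (g (X j \<omega>)))\<^sup>2 \<partial>\<Omega>) / real CARD('b))
      + L * \<alpha>\<^sup>2 / 2 * (\<sigma>\<^sub>1\<^sup>2 / real m)"
    unfolding a_def using projected_gradient_lower_bound[OF j] \<alpha>(3)
    by (intro add_right_mono diff_left_mono mult_left_mono) auto
  finally show ?thesis
    unfolding eq \<alpha>(2) unfolding \<alpha>(1) by (simp add: mult_ac)
qed

text \<open>Successive instances of \<open>expected_step\<close> cancel the intermediate expected
  objectives. The sum starts at \<open>k\<^sub>0 - 1\<close>, the index of the deterministic
  starting point.\<close>

lemma telescoped:
  assumes "k\<^sub>0 \<le> Suc N"
  shows "(\<integral>\<omega>. obj (X (Suc N) \<omega>) \<partial>\<Omega>)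
      + (\<Sum>j=k\<^sub>0-1..N. (\<integral>\<omega>. (norm (g (X j \<omega>)))\<^sup>2 \<partial>\<Omega>) / (2 * real CARD('b) * L * sqrt (real j + 1)))
    \<le> obj x\<^sub>0 + \<sigma>\<^sub>1\<^sup>2 / (2 * L * real m) * (\<Sum>j=k\<^sub>0-1..N. 1 / (real j + 1))"
proof -
  have "k\<^sub>0 - 1 \<le> N"
    using assms by simp
  then show ?thesis
  proof (induction N rule: dec_induct)
    case base
    have "(\<integral>\<omega>. obj (X (k\<^sub>0 - 1) \<omega>) \<partial>\<Omega>) = (\<integral>\<omega>. obj x\<^sub>0 \<partial>\<Omega>)"
    proof (rule integral_cong_AE)
      show "AE \<omega> in \<Omega>. obj (X (k\<^sub>0 - 1) \<omega>) = obj x\<^sub>0"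
        using start by eventually_elim simp
    qed (use integrable_obj[of "k\<^sub>0 - 1"] in auto)
    then show ?case
      using expected_step[of "k\<^sub>0 - 1"] by (simp add: prob_space)
  next
    case (step N)
    have split: "(\<Sum>j=k\<^sub>0-1..Suc N. h j) = (\<Sum>j=k\<^sub>0-1..N. h j) + h (Suc N)" for h :: "nat \<Rightarrow> real"
      using step.hyps by simp
    have "k\<^sub>0 \<le> Suc (Suc N)"
      using step.hyps by simp
    from expected_step[OF this] step.IH show ?case
      unfolding split distrib_left by linarith
  qed
qed

text \<open>The weights 1 / sqrt (j + 1) decrease, so each of the N + 1 - \<open>k\<^sub>0\<close>
  summands is at least y times the last weight. The telescoped bound and the logarithmic growth of
  the harmonic sum finish the estimate.\<close>

lemma min_gradient_bound:
  assumes N: "k\<^sub>0 \<le> N" and y: "y \<ge> 0"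
    and min: "\<And>t. t \<in> {k\<^sub>0..N} \<Longrightarrow> y \<le> (\<integral>\<omega>. (norm (g (X t \<omega>)))\<^sup>2 \<partial>\<Omega>)"
  shows "1 / real CARD('b) / (2 * L) * y * ((real N + 1 - real k\<^sub>0) / sqrt (real N + 1))
    \<le> (obj x\<^sub>0 - fl) + \<sigma>\<^sub>1\<^sup>2 / (2 * L * real m) * (2 + ln (real N))"
proof -
  let ?G = "\<lambda>j. \<integral>\<omega>. (norm (g (X j \<omega>)))\<^sup>2 \<partial>\<Omega>"
  let ?w = "\<lambda>j. 2 * real CARD('b) * L * sqrt (real j + 1)"
  have N1: "N \<ge> 1"
    using N k0 by simp
  have "(\<Sum>j=k\<^sub>0-1..N. 1 / (real j + 1)) = (\<Sum>j=Suc (k\<^sub>0-1)..Suc N. 1 / real j)"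
    by (subst sum.atLeast_Suc_atMost_Suc_shift) (simp add: add.commute)
  also have "\<dots> \<le> (\<Sum>j=1..Suc N. 1 / real j)"
    by (intro sum_mono2) auto
  also have "\<dots> \<le> 1 + ln (real (Suc N))"
    by (intro harmonic_sum_le) simp
  also have "\<dots> \<le> 2 + ln (real N)"
  proof -
    have "ln (real (Suc N)) \<le> ln (2 * real N)"
      using N1 by (subst ln_le_cancel_iff) auto
    also have "\<dots> = ln 2 + ln (real N)"
      using N1 by (intro ln_mult_pos) auto
    finally show ?thesis
      using ln_le_minus_one[of 2] by simp
  qed
  finally have harm: "(\<Sum>j=k\<^sub>0-1..N. 1 / (real j + 1)) \<le> 2 + ln (real N)" .
  have "1 / real CARD('b) / (2 * L) * y * ((real N + 1 - real k\<^sub>0) / sqrt (real N + 1))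
      = (\<Sum>j=k\<^sub>0..N. y / ?w N)"
    using N by (simp add: add.commute mult_ac)
  also have "\<dots> \<le> (\<Sum>j=k\<^sub>0..N. ?G j / ?w j)"
    using min L y by (intro sum_mono frac_le) (auto intro: order_trans)
  \<comment> \<open>The minimum ranges over indices from \<open>k\<^sub>0\<close> on, while the
    telescoped sum also contains the starting point; its summand is nonnegative.\<close>
  also have "\<dots> \<le> (\<Sum>j=k\<^sub>0-1..N. ?G j / ?w j)"
    using L by (intro sum_mono2) auto
  also have "\<dots> \<le> obj x\<^sub>0 + \<sigma>\<^sub>1\<^sup>2 / (2 * L * real m) * (\<Sum>j=k\<^sub>0-1..N. 1 / (real j + 1)) - fl"
  proof -
    have "(\<integral>\<omega>. fl \<partial>\<Omega>) \<le> (\<integral>\<omega>. obj (X (Suc N) \<omega>) \<partial>\<Omega>)"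
      using N lower by (intro integral_mono integrable_obj) auto
    then show ?thesis
      using telescoped[of N] N by (simp add: prob_space)
  qed
  also have "\<dots> \<le> obj x\<^sub>0 + \<sigma>\<^sub>1\<^sup>2 / (2 * L * real m) * (2 + ln (real N)) - fl"
    using L harm by (intro diff_right_mono add_left_mono mult_left_mono) auto
  finally show ?thesis
    by simp
qed

end

subsection \<open>The condition on the number of iterations\<close>

lemma iteration_exponents_sum:
  fixes \<beta> :: real
  assumes "0 < \<beta>"
  shows "(1 - \<beta>) / (2 * (1 + \<beta>)) + \<beta> / (1 + \<beta>) = 1 / 2"
proof -
  have "\<beta> / (1 + \<beta>) = 2 * \<beta> / (2 * (1 + \<beta>))"
    by (rule mult_divide_mult_cancel_left[symmetric]) simp
  then have "(1 - \<beta>) / (2 * (1 + \<beta>)) + \<beta> / (1 + \<beta>) = (1 + \<beta>) / (2 * (1 + \<beta>))"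
    by (simp only: add_divide_distrib[symmetric]) simp
  also have "\<dots> = 1 / 2"
    using assms mult_divide_mult_cancel_right[of "1 + \<beta>" 1 2] by simp
  finally show ?thesis .
qed

text \<open>Both summands on the left are nonnegative. The second alone gives sqrt
  \<open>k\<^sub>0\<close> \<le> c * sqrt N, because the exponents add up to 1 / 2, and c \<le> 1 /
  2 yields the first claim. Then \<open>k\<^sub>0\<close> / N \<le> 1 / 4 keeps a fixed fraction of
  the first summand; the positive second one makes the inequality strict.\<close>

lemma enough_iterationsD:
  assumes enough: "enough_iterations c \<beta> k\<^sub>0 \<epsilon> N"
    and "0 < \<beta>" "\<beta> < 1" "0 < c" "c \<le> 1 / 2" "k\<^sub>0 > 0" "\<epsilon> > 0"
  shows "4 * real k\<^sub>0 \<le> real N"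
    and "(1 - (1 / 4) powr (\<beta> / (1 + \<beta>))) / \<epsilon>\<^sup>2 < c * real N powr ((1 - \<beta>) / (2 * (1 + \<beta>)))"
proof -
  define p q where "p = \<beta> / (1 + \<beta>)" and "q = (1 - \<beta>) / (2 * (1 + \<beta>))"
  have p: "p > 0" and pq: "q + p = 1 / 2"
    using assms iteration_exponents_sum by (simp_all add: p_def q_def)
  have N: "real N > 0" "k\<^sub>0 \<le> N"
    and le: "1 / \<epsilon>\<^sup>2 * (1 - (real k\<^sub>0 / real N) powr p) + sqrt (real k\<^sub>0) / real N powr p \<le> c * real N powr q"
    using assms unfolding enough_iterations_def p_def q_def by auto
  have "(real k\<^sub>0 / real N) powr p \<le> 1"
    using N p by (intro powr_le1) auto
  then have "0 \<le> 1 / \<epsilon>\<^sup>2 * (1 - (real k\<^sub>0 / real N) powr p)"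
    by simp
  then have "sqrt (real k\<^sub>0) / real N powr p \<le> c * real N powr q"
    using le by linarith
  then have "sqrt (real k\<^sub>0) \<le> c * real N powr q * real N powr p"
    using N by (simp add: pos_divide_le_eq)
  also have "\<dots> = c * sqrt (real N)"
    using N by (simp add: mult.assoc pq powr_half_sqrt flip: powr_add)
  also have "\<dots> \<le> 1 / 2 * sqrt (real N)"
    using assms by (intro mult_right_mono) auto
  finally have "sqrt (4 * real k\<^sub>0) \<le> sqrt (real N)"
    by (simp add: real_sqrt_mult)
  then show *: "4 * real k\<^sub>0 \<le> real N"
    by simp
  have "(real k\<^sub>0 / real N) powr p \<le> (1 / 4) powr p"
    using * N p by (intro powr_mono2) (auto simp: field_simps)
  then have "(1 - (1 / 4) powr p) / \<epsilon>\<^sup>2 \<le> 1 / \<epsilon>\<^sup>2 * (1 - (real k\<^sub>0 / real N) powr p)"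
    by (simp add: divide_right_mono)
  moreover have "0 < sqrt (real k\<^sub>0) / real N powr p"
    using N assms by simp
  ultimately show "(1 - (1 / 4) powr (\<beta> / (1 + \<beta>))) / \<epsilon>\<^sup>2
      < c * real N powr ((1 - \<beta>) / (2 * (1 + \<beta>)))"
    using le unfolding p_def q_def by linarith
qed

text \<open>Solves a / \<epsilon>^2 \<le> x powr q for x by monotonicity of positive powers. It
  translates between conditions on powers of N and thresholds for N, in both directions.\<close>

lemma powr_inverse_le:
  fixes a q x \<epsilon> :: real
  assumes "a > 0" "q > 0" "\<epsilon> > 0" "x \<ge> 0"
  shows "a powr (1 / q) * \<epsilon> powr (- 2 / q) \<le> x \<longleftrightarrow> a / \<epsilon>\<^sup>2 \<le> x powr q"
proof -
  have "\<epsilon> powr (- 2 / q) = (1 / \<epsilon>\<^sup>2) powr (1 / q)"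
  proof -
    have "1 / \<epsilon>\<^sup>2 = \<epsilon> powr (- 2)"
      using assms by (simp add: powr_minus_divide powr_numeral)
    then show ?thesis
      by (simp add: powr_powr)
  qed
  then have "a powr (1 / q) * \<epsilon> powr (- 2 / q) = (a / \<epsilon>\<^sup>2) powr (1 / q)"
    using assms by (simp add: powr_divide)
  moreover have "(a / \<epsilon>\<^sup>2) powr (1 / q) \<le> x \<longleftrightarrow> ((a / \<epsilon>\<^sup>2) powr (1 / q)) powr q \<le> x powr q"
    using assms by (metis linorder_not_less powr_ge_zero powr_less_mono2 powr_mono2 less_imp_le)
  ultimately show ?thesis
    using assms by (simp add: powr_powr)
qed

lemma iteration_exponent:
  fixes \<beta> :: real
  assumes "0 < \<beta>" "\<beta> < 1"
  shows "- 4 * ((1 + \<beta>) / (1 - \<beta>)) = - 2 / ((1 - \<beta>) / (2 * (1 + \<beta>)))"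
  using assms by (simp add: field_simps)

text \<open>The second consequence of the condition, solved for N: the stated order in \<epsilon>
  cannot be undercut.\<close>

lemma enough_iterations_lower:
  assumes "enough_iterations c \<beta> k\<^sub>0 \<epsilon> N"
    and "0 < \<beta>" "\<beta> < 1" "0 < c" "c \<le> 1 / 2" "k\<^sub>0 > 0" "\<epsilon> > 0"
  shows "((1 - (1 / 4) powr (\<beta> / (1 + \<beta>))) / c) powr (1 / ((1 - \<beta>) / (2 * (1 + \<beta>))))
      * \<epsilon> powr (- 4 * ((1 + \<beta>) / (1 - \<beta>))) \<le> real N"
  unfolding iteration_exponent[OF assms(2,3)]
proof (subst powr_inverse_le)
  have "(1 / 4 :: real) powr (\<beta> / (1 + \<beta>)) < 1 powr (\<beta> / (1 + \<beta>))"
    using assms by (intro powr_less_mono2) auto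
  then show "0 < (1 - (1 / 4) powr (\<beta> / (1 + \<beta>))) / c"
    using assms by simp
  show "(1 - (1 / 4) powr (\<beta> / (1 + \<beta>))) / c / \<epsilon>\<^sup>2 \<le> real N powr ((1 - \<beta>) / (2 * (1 + \<beta>)))"
    unfolding divide_divide_eq_left mult.commute[of c]
    unfolding divide_divide_eq_left[symmetric] pos_divide_le_eq[OF assms(4)]
    using enough_iterationsD(2)[OF assms] by (simp add: mult.commute)
qed (use assms in auto)

text \<open>Each summand of the condition receives half of the right-hand side. The first then asks
  for 2 / (c * \<epsilon>^2) \<le> N powr e, the second for a lower bound on N free of \<epsilon>,
  which the first implies once \<epsilon> is small.\<close>

lemma eventually_enough_iterations:
  assumes "0 < \<beta>" "\<beta> < 1" "0 < c"
  defines "e \<equiv> (1 - \<beta>) / (2 * (1 + \<beta>))"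
  shows "\<forall>\<^sub>F \<epsilon> in at_right 0. \<forall>N. (2 / c) powr (1 / e) * \<epsilon> powr (- 4 * ((1 + \<beta>) / (1 - \<beta>))) \<le> real N \<longrightarrow>
      enough_iterations c \<beta> k\<^sub>0 \<epsilon> N"
proof -
  define p where "p = \<beta> / (1 + \<beta>)"
  have e: "e > 0" and p: "p > 0" and pe: "e + p = 1 / 2"
    using assms iteration_exponents_sum[of \<beta>] by (simp_all add: p_def e_def)
  \<comment> \<open>The first entry ensures \<open>k\<^sub>0 \<le> N\<close>, the second sqrt
    \<open>k\<^sub>0\<close> \<le> c / 2 * sqrt N, and the added 1 makes N positive.\<close>
  define K where "K = max (real k\<^sub>0) (4 * real k\<^sub>0 / c\<^sup>2) + 1"
  have large: "enough_iterations c \<beta> k\<^sub>0 \<epsilon> N"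
    if "\<epsilon> > 0" "K \<le> real N" "2 / c / \<epsilon>\<^sup>2 \<le> real N powr e" for \<epsilon> N
    unfolding enough_iterations_def p_def[symmetric] e_def[symmetric]
  proof
    have N: "real k\<^sub>0 \<le> real N" "4 * real k\<^sub>0 / c\<^sup>2 \<le> real N" "real N > 0"
      using that unfolding K_def by linarith+
    then show "k\<^sub>0 \<le> N" by simp
    have "1 / \<epsilon>\<^sup>2 * (1 - (real k\<^sub>0 / real N) powr p) \<le> 1 / \<epsilon>\<^sup>2 * 1"
      by (intro mult_left_mono) auto
    also have "\<dots> \<le> c / 2 * real N powr e"
      using that assms by (simp add: field_simps)
    finally have 1: "1 / \<epsilon>\<^sup>2 * (1 - (real k\<^sub>0 / real N) powr p) \<le> c / 2 * real N powr e" .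
    have "real k\<^sub>0 \<le> (c / 2)\<^sup>2 * real N"
      using N assms by (simp add: field_simps power2_eq_square)
    then have "sqrt (real k\<^sub>0) \<le> sqrt ((c / 2)\<^sup>2 * real N)"
      by (rule real_sqrt_le_mono)
    also have "\<dots> = c / 2 * (real N powr e * real N powr p)"
      using N assms(3) by (simp add: real_sqrt_mult pe powr_half_sqrt flip: powr_add)
    finally have 2: "sqrt (real k\<^sub>0) / real N powr p \<le> c / 2 * real N powr e"
      using N by (simp add: field_simps)
    show "1 / \<epsilon>\<^sup>2 * (1 - (real k\<^sub>0 / real N) powr p) + sqrt (real k\<^sub>0) / real N powr p \<le> c * real N powr e"
      using add_mono[OF 1 2] by simp
  qed
  have "((\<lambda>\<epsilon>. K powr e * \<epsilon>\<^sup>2) \<longlongrightarrow> 0) (at_right 0)"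
    by (auto intro!: tendsto_eq_intros)
  then have "\<forall>\<^sub>F \<epsilon> in at_right 0. K powr e * \<epsilon>\<^sup>2 < 2 / c"
    using assms(3) by (intro order_tendstoD(2)[where y = 0]) auto
  moreover have "\<forall>\<^sub>F \<epsilon> in at_right (0::real). \<epsilon> > 0"
    by (simp add: eventually_at_right_less)
  ultimately show ?thesis
    unfolding iteration_exponent[OF assms(1,2)] e_def[symmetric]
  proof eventually_elim
    case (elim \<epsilon>)
    have "K \<le> real N" if "2 / c / \<epsilon>\<^sup>2 \<le> real N powr e" for N
    proof (rule ccontr)
      assume "\<not> K \<le> real N"
      then have "real N powr e < K powr e"
        using e by (intro powr_less_mono2) auto
      also have "\<dots> \<le> 2 / c / \<epsilon>\<^sup>2"
        using elim by (subst pos_le_divide_eq) auto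
      finally show False
        using that by simp
    qed
    then show ?case
      using elim large[of \<epsilon>] powr_inverse_le[of "2 / c" e \<epsilon>] e assms(3) by simp
  qed
qed

text \<open>The ceiling of the threshold is an admissible N. For \<epsilon> < 1 the power of
  \<epsilon> is at least 1, so rounding up costs at most one more multiple of it.\<close>

lemma Least_enough_iterations_bigo:
  assumes "\<forall>\<^sub>F \<epsilon> in at_right 0. \<forall>N. C * \<epsilon> powr (- 4 * ((1 + \<beta>) / (1 - \<beta>))) \<le> real N \<longrightarrow>
      enough_iterations c \<beta> k\<^sub>0 \<epsilon> N"
    and "0 < \<beta>" "\<beta> < 1" "0 < C"
  shows "(\<lambda>\<epsilon>. real (LEAST N. enough_iterations c \<beta> k\<^sub>0 \<epsilon> N))
    \<in> O[at_right 0](\<lambda>\<epsilon>. \<epsilon> powr (- 4 * ((1 + \<beta>) / (1 - \<beta>))))"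
proof (rule bigoI)
  have "\<forall>\<^sub>F \<epsilon> in at_right (0::real). \<epsilon> < 1"
    by (intro eventually_at_rightI[of 0 1]) auto
  moreover have "\<forall>\<^sub>F \<epsilon> in at_right (0::real). \<epsilon> > 0"
    by (simp add: eventually_at_right_less)
  ultimately show "\<forall>\<^sub>F \<epsilon> in at_right 0. norm (real (LEAST N. enough_iterations c \<beta> k\<^sub>0 \<epsilon> N))
      \<le> (C + 1) * norm (\<epsilon> powr (- 4 * ((1 + \<beta>) / (1 - \<beta>))))"
    using assms(1)
  proof eventually_elim
    case (elim \<epsilon>)
    define y where "y = \<epsilon> powr (- 4 * ((1 + \<beta>) / (1 - \<beta>)))"
    have y: "y \<ge> 1"
      using elim assms(2,3) powr_mono'[of "- 4 * ((1 + \<beta>) / (1 - \<beta>))" 0 \<epsilon>]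
      by (simp add: y_def divide_nonpos_pos)
    have "enough_iterations c \<beta> k\<^sub>0 \<epsilon> (nat \<lceil>C * y\<rceil>)"
      using elim real_nat_ceiling_ge[of "C * y"] unfolding y_def by blast
    then have "(LEAST N. enough_iterations c \<beta> k\<^sub>0 \<epsilon> N) \<le> nat \<lceil>C * y\<rceil>"
      by (rule Least_le)
    also have "real (nat \<lceil>C * y\<rceil>) \<le> C * y + 1"
      using y assms(4) by (simp add: of_nat_ceiling)
    also have "\<dots> \<le> (C + 1) * y"
      using y by (simp add: algebra_simps)
    finally show ?case
      using y by (simp add: y_def)
  qed
qed

text \<open>As N \<ge> 4 \<open>k\<^sub>0\<close>, at least three quarters of N steps remain and the
  quotient in the hypothesis is at least sqrt N / 2. The logarithm is absorbed into N powr p at the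
  price of a factor 1 / p; cancelling N powr p from sqrt N leaves N powr q.\<close>

lemma rate_bound:
  fixes D S \<kappa> L y p q :: real and N :: nat
  assumes "\<kappa> > 0" "L > 0" "D \<ge> 0" "S \<ge> 0" "p > 0" "k\<^sub>0 > 0"
    and qp: "q + p = 1 / 2" and k0: "4 * real k\<^sub>0 \<le> real N"
    and sum: "\<kappa> / (2 * L) * y * ((real N + 1 - real k\<^sub>0) / sqrt (real N + 1)) \<le> D + S * (2 + ln (real N))"
    and y: "y \<ge> 0"
  shows "y * real N powr q \<le> 4 * L / \<kappa> * ((D + 2 * S) * (1 + 1 / p))"
proof -
  have N: "real N \<ge> 1"
    using k0 \<open>k\<^sub>0 > 0\<close> by simp
  have "sqrt (real N + 1) \<le> 3 / 2 * sqrt (real N)"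
    using N by (intro real_le_lsqrt) (auto simp: power_mult_distrib power2_eq_square)
  moreover have "real N + 1 - real k\<^sub>0 \<ge> 3 / 4 * real N"
    using k0 by simp
  ultimately have "3 / 4 * real N / (3 / 2 * sqrt (real N)) \<le> (real N + 1 - real k\<^sub>0) / sqrt (real N + 1)"
    using N by (intro frac_le) auto
  also have "3 / 4 * real N / (3 / 2 * sqrt (real N)) = sqrt (real N) / 2"
    using N by (simp add: field_simps)
  finally have "\<kappa> / (2 * L) * y * (sqrt (real N) / 2)
      \<le> \<kappa> / (2 * L) * y * ((real N + 1 - real k\<^sub>0) / sqrt (real N + 1))"
    using assms by (intro mult_left_mono) auto
  also have "\<dots> \<le> D + S * (2 + ln (real N))"
    by (rule sum)
  also have "\<dots> \<le> (D + 2 * S) * (1 + ln (real N))"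
    using N assms by (simp add: algebra_simps)
  also have "\<dots> \<le> (D + 2 * S) * ((1 + 1 / p) * real N powr p)"
  proof (intro mult_left_mono)
    have "1 \<le> real N powr p" "ln (real N) \<le> real N powr p / p"
      using N assms by (auto intro: ge_one_powr_ge_zero ln_powr_bound)
    then show "1 + ln (real N) \<le> (1 + 1 / p) * real N powr p"
      by (simp add: algebra_simps)
  qed (use assms in auto)
  finally have "\<kappa> / (4 * L) * y * sqrt (real N) \<le> (D + 2 * S) * (1 + 1 / p) * real N powr p"
    by (simp add: mult_ac)
  moreover have "sqrt (real N) = real N powr q * real N powr p"
    unfolding powr_add[symmetric] qp by (simp add: powr_half_sqrt)
  ultimately have "(\<kappa> / (4 * L) * (y * real N powr q)) * real N powr p
      \<le> ((D + 2 * S) * (1 + 1 / p)) * real N powr p"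
    by (simp add: mult_ac)
  then have "\<kappa> / (4 * L) * (y * real N powr q) \<le> (D + 2 * S) * (1 + 1 / p)"
    using N by (simp only: mult_le_cancel_right) auto
  then show ?thesis
    using assms by (simp add: field_simps)
qed

text \<open>The constants are quantified before the run, so they depend on the problem parameters
  but not on \<open>k\<^sub>0\<close>, \<epsilon> or N. The equivalence is expressed by matching
  lower and upper thresholds for N, with the order of the least admissible N as a
  consequence.\<close>

theorem theorem7:
  fixes f :: "nat \<Rightarrow> real^'n \<Rightarrow> real" and M m :: nat and L \<sigma>\<^sub>1 \<gamma>\<^sub>0 \<delta> \<beta> :: real
    and x\<^sub>0 :: "real^'n"
  assumes "M \<ge> 1" and "m \<ge> 1" and "L > 0" and "\<sigma>\<^sub>1 \<ge> 0"
    and "0 < \<gamma>\<^sub>0" and "\<gamma>\<^sub>0 < 1" and "0 < \<delta>" and "2 * \<delta> < \<gamma>\<^sub>0"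
    and "0 < \<beta>" and "\<beta> < 1"
    and "\<forall>i\<in>{1..M}. L_smooth L (f i)"
    and "bdd_below (range (objective M f))"
    and "variance_bound M f \<sigma>\<^sub>1"
  shows "\<exists>c>0. \<exists>C\<^sub>1>0. \<exists>C\<^sub>2>0.
    \<forall>(\<Omega> :: 'w measure) r i\<^sub>s k\<^sub>0 F G H X V (Pt :: nat \<Rightarrow> 'w \<Rightarrow> real^'d^'n) B R m'.
      refresh_schedule \<beta> r \<longrightarrow>
      k\<^sub>0 > 0 \<longrightarrow> k\<^sub>0 = r i\<^sub>s \<longrightarrow> real i\<^sub>s \<ge> (5 / ln (\<gamma>\<^sub>0 / (2 * \<delta>))) powr (2 / (1 - \<beta>)) \<longrightarrow>
      ssgdpm \<Omega> M f L \<sigma>\<^sub>1 \<gamma>\<^sub>0 m x\<^sub>0 r k\<^sub>0 F G H X V Pt B R m' \<longrightarrow>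
        (\<forall>\<epsilon>>0. \<forall>N \<tau>. enough_iterations c \<beta> k\<^sub>0 \<epsilon> N \<longrightarrow>
           is_arg_min (\<lambda>t. \<integral>\<omega>. (norm (grad (objective M f) (X t \<omega>)))\<^sup>2 \<partial>\<Omega>) (\<lambda>t. t \<in> {k\<^sub>0..N}) \<tau> \<longrightarrow>
           (\<integral>\<omega>. (norm (grad (objective M f) (X \<tau> \<omega>)))\<^sup>2 \<partial>\<Omega>) < \<epsilon>\<^sup>2) \<and>
        (\<forall>\<epsilon>>0. \<forall>N. enough_iterations c \<beta> k\<^sub>0 \<epsilon> N \<longrightarrow>
           C\<^sub>1 * \<epsilon> powr (- 4 * ((1 + \<beta>) / (1 - \<beta>))) \<le> real N) \<and>
        (\<forall>\<^sub>F \<epsilon> in at_right 0. \<forall>N. C\<^sub>2 * \<epsilon> powr (- 4 * ((1 + \<beta>) / (1 - \<beta>))) \<le> real N \<longrightarrow>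
           enough_iterations c \<beta> k\<^sub>0 \<epsilon> N) \<and>
        (\<lambda>\<epsilon>. real (LEAST N. enough_iterations c \<beta> k\<^sub>0 \<epsilon> N))
           \<in> O[at_right 0](\<lambda>\<epsilon>. \<epsilon> powr (- 4 * ((1 + \<beta>) / (1 - \<beta>))))"
proof -
  define p q \<rho> where "p = \<beta> / (1 + \<beta>)" and "q = (1 - \<beta>) / (2 * (1 + \<beta>))"
    and "\<rho> = (1 / 4 :: real) powr p"
  have p: "p > 0" and q: "q > 0" and qp: "q + p = 1 / 2"
    using assms iteration_exponents_sum[of \<beta>] by (simp_all add: p_def q_def)
  have \<rho>: "\<rho> < 1"
    unfolding \<rho>_def using p powr_less_mono2[of p "1 / 4" 1] by simp
  obtain fl where fl: "\<And>x. fl \<le> objective M f x"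
    using assms(12) unfolding bdd_below_def by blast
  \<comment> \<open>D is the largest possible total decrease, S the coefficient of the noise, and K
    the right-hand side of \<open>rate_bound\<close> for \<kappa> = 1 / n.\<close>
  define D S K where "D = objective M f x\<^sub>0 - fl" and "S = \<sigma>\<^sub>1\<^sup>2 / (2 * L * real m)"
    and "K = 4 * L / (1 / real CARD('n)) * ((D + 2 * S) * (1 + 1 / p))"
  have D: "D \<ge> 0" and S: "S \<ge> 0"
    using fl assms by (simp_all add: D_def S_def)
  have K: "K \<ge> 0"
    unfolding K_def using assms p D S by simp
  \<comment> \<open>The entry 1 / 2 forces 4 \<open>k\<^sub>0\<close> \<le> N; the other makes
    \<epsilon>^2 * N powr q exceed K + 1. Adding 1 keeps the denominator positive even for K =
    0.\<close>
  define c where "c = min (1 / 2) ((1 - \<rho>) / (K + 1))"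
  have "0 < c"
    using \<rho> K by (simp add: c_def)
  moreover have "c \<le> 1 / 2" and cK: "c \<le> (1 - \<rho>) / (K + 1)"
    unfolding c_def by (rule min.cobounded1, rule min.cobounded2)
  ultimately have c: "0 < c" "c \<le> 1 / 2"
    by blast+
  show ?thesis
  proof (rule exI[of _ c], rule conjI[OF c(1)],
      rule exI[of _ "((1 - \<rho>) / c) powr (1 / q)"], rule conjI[rotated],
      rule exI[of _ "(2 / c) powr (1 / q)"], rule conjI[rotated], intro allI impI conjI)
    show "0 < ((1 - \<rho>) / c) powr (1 / q)" "0 < (2 / c) powr (1 / q)"
      using c \<rho> by simp_all
    fix \<Omega> :: "'w measure" and r :: "nat \<Rightarrow> nat" and i\<^sub>s k\<^sub>0 :: nat and F G H :: "nat \<Rightarrow> 'w measure"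
      and X V and Pt :: "nat \<Rightarrow> 'w \<Rightarrow> real^'d^'n" and B R m'
    assume k\<^sub>0: "k\<^sub>0 > 0" and run: "ssgdpm \<Omega> M f L \<sigma>\<^sub>1 \<gamma>\<^sub>0 m x\<^sub>0 r k\<^sub>0 F G H X V Pt B R m'"
    interpret smooth_ssgdpm \<Omega> M f L \<sigma>\<^sub>1 \<gamma>\<^sub>0 m x\<^sub>0 r k\<^sub>0 F G H X V Pt B R m' fl
      using run assms k\<^sub>0 fl by (intro smooth_ssgdpm.intro smooth_ssgdpm_axioms.intro)
    show "(\<integral>\<omega>. (norm (grad (objective M f) (X \<tau> \<omega>)))\<^sup>2 \<partial>\<Omega>) < \<epsilon>\<^sup>2"
      if \<epsilon>: "\<epsilon> > 0" and enough: "enough_iterations c \<beta> k\<^sub>0 \<epsilon> N"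
        and min: "is_arg_min (\<lambda>t. \<integral>\<omega>. (norm (grad (objective M f) (X t \<omega>)))\<^sup>2 \<partial>\<Omega>) (\<lambda>t. t \<in> {k\<^sub>0..N}) \<tau>"
      for \<epsilon> N \<tau>
    proof -
      define y where "y = (\<integral>\<omega>. (norm (grad (objective M f) (X \<tau> \<omega>)))\<^sup>2 \<partial>\<Omega>)"
      have y: "y \<ge> 0"
        by (simp add: y_def)
      have *: "4 * real k\<^sub>0 \<le> real N" "(1 - \<rho>) / \<epsilon>\<^sup>2 < c * real N powr q"
        using enough_iterationsD[OF enough assms(9,10) c k\<^sub>0 \<epsilon>] by (simp_all add: p_def q_def \<rho>_def)
      then have N: "k\<^sub>0 \<le> N" "real N > 0"
        using k\<^sub>0 by linarith+
      have "y * real N powr q \<le> K"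
        unfolding K_def
      proof (rule rate_bound[OF _ assms(3) D S p k\<^sub>0 qp *(1) _ y])
        show "1 / real CARD('n) / (2 * L) * y * ((real N + 1 - real k\<^sub>0) / sqrt (real N + 1))
            \<le> D + S * (2 + ln (real N))"
          unfolding D_def S_def
        proof (rule min_gradient_bound[OF N(1) y])
          show "y \<le> (\<integral>\<omega>. (norm (grad (objective M f) (X t \<omega>)))\<^sup>2 \<partial>\<Omega>)" if "t \<in> {k\<^sub>0..N}" for t
            using min that unfolding is_arg_min_def y_def by (meson not_less)
        qed
      qed simp
      also have "K < K + 1" by simp
      \<comment> \<open>The choice of c bounds c * N powr q by (1 - \<rho>) / (K + 1) * N powr q,
        and the positive factor 1 - \<rho> cancels. Dividing by N powr q afterwards gives y <
        \<epsilon>^2.\<close>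
      also have "K + 1 < \<epsilon>\<^sup>2 * real N powr q"
      proof -
        have "c * real N powr q \<le> (1 - \<rho>) / (K + 1) * real N powr q"
          using cK by (intro mult_right_mono) auto
        with *(2) have "(1 - \<rho>) / \<epsilon>\<^sup>2 < (1 - \<rho>) / (K + 1) * real N powr q"
          by simp
        then have "(1 - \<rho>) * (K + 1) < (1 - \<rho>) * (\<epsilon>\<^sup>2 * real N powr q)"
          using K \<epsilon> by (simp add: field_simps)
        then show ?thesis
          using \<rho> by simp
      qed
      finally show ?thesis
        using N unfolding y_def[symmetric] by simp
    qed
    show "((1 - \<rho>) / c) powr (1 / q) * \<epsilon> powr (- 4 * ((1 + \<beta>) / (1 - \<beta>))) \<le> real N"
      if "\<epsilon> > 0" "enough_iterations c \<beta> k\<^sub>0 \<epsilon> N" for \<epsilon> N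
      using enough_iterations_lower[OF that(2) assms(9,10) c k\<^sub>0 that(1)]
      by (simp add: p_def q_def \<rho>_def)
    show ev: "\<forall>\<^sub>F \<epsilon> in at_right 0. \<forall>N. (2 / c) powr (1 / q) * \<epsilon> powr (- 4 * ((1 + \<beta>) / (1 - \<beta>))) \<le> real N \<longrightarrow>
        enough_iterations c \<beta> k\<^sub>0 \<epsilon> N"
      unfolding q_def using assms(9,10) c(1) by (rule eventually_enough_iterations)
    show "(\<lambda>\<epsilon>. real (LEAST N. enough_iterations c \<beta> k\<^sub>0 \<epsilon> N))
        \<in> O[at_right 0](\<lambda>\<epsilon>. \<epsilon> powr (- 4 * ((1 + \<beta>) / (1 - \<beta>))))"
      using c by (intro Least_enough_iterations_bigo[OF ev assms(9,10)]) simp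
  qed
qed

end
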